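(* Let $(E,[\cdot,\cdot])$ be a locally convex Poisson vector space with respect to $\mathcal{S}=c$ and $U\subseteq E$ open. Then the map $\Psi\colon C^\infty_{\mathbb{K}}(U,\mathbb{K})\to C^\infty_{\mathbb{K}}(U,E)$, $f\mapsto X_f$, is continuous and linear.
   Context: $E'_c$ is the dual of $E$ with the topology of uniform convergence on compact sets. A Hausdorff space is a $k^\infty$-space if all its finite powers are $k$-spaces. A locally convex Poisson vector space w.r.t. $c$ is a locally convex space $E$ which is a $k^\infty$-space, whose evaluation map $\eta_E\colon E\to(E'_c)'_c$, $\eta_E(x)(\lambda)=\lambda(x)$, is a topological embedding, with a bilinear map $[\cdot,\cdot]\colon E'_c\times E'_c\to E'_c$ making $E'$ a Lie algebra, hypocontinuous in the second argument with respect to compact subsets of $E'_c$ (separately continuous, and for each compact $M$ and $0$-neighbourhood $W$ there is a $0$-neighbourhood $V$ with $[V,M]\subseteq W$), and with $\eta_E(x)\circ\mathrm{ad}_\lambda\in\eta_E(E)$ for all $x\in E$, $\lambda\in E'$, where $\mathrm{ad}_\lambda=[\lambda,\cdot]$. For $f\in C^\infty_{\mathbb{K}}(U,\mathbb{K})$, $X_f(x)=\eta_E^{-1}(\eta_E(x)\circ\mathrm{ad}(f'(x)))$ with $f'(x)=df(x,\cdot)$. $C^\infty_{\mathbb{K}}(U,F)$ carries the $C^\infty$-topology: initial topology w.r.t. $f\mapsto d^kf\in C(U\times E^k,F)$ with compact-open topology, $k\in\mathbb{N}_0$, where $d^kf$ are iterated directional derivatives. *)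

theory Defs
  imports "HOL-Analysis.Analysis"
begin

text \<open>Scalars: a type 'k of class real_normed_field (by Mazur's theorem, R or C).
  The locally convex space E is a type 'e with its type-class topology, an additive
  group structure and a scalar multiplication scE over 'k.\<close>

definition lc_space :: "('k::real_normed_field \<Rightarrow> 'e::{ab_group_add,t2_space} \<Rightarrow> 'e) \<Rightarrow> bool" where
  "lc_space scE \<longleftrightarrow>
     Vector_Spaces.vector_space scE \<and>
     continuous_on UNIV (\<lambda>p::'e \<times> 'e. fst p + snd p) \<and>
     continuous_on UNIV (\<lambda>p::'k \<times> 'e. scE (fst p) (snd p)) \<and>
     Hausdorff_space (euclidean :: 'e topology) \<and>
     (\<forall>W. open W \<and> (0::'e) \<in> W \<longrightarrow>
        (\<exists>V. open V \<and> 0 \<in> V \<and> V \<subseteq> W \<and>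
           (\<forall>x\<in>V. \<forall>y\<in>V. \<forall>t::real. 0 \<le> t \<and> t \<le> 1 \<longrightarrow>
               scE (of_real t) x + scE (of_real (1 - t)) y \<in> V)))"

definition k_infinity_space :: "'a topology \<Rightarrow> bool" where
  "k_infinity_space X \<longleftrightarrow> Hausdorff_space X \<and>
     (\<forall>n::nat. k_space (product_topology (\<lambda>_. X) {..<n}))"

definition uc_topology :: "'a topology \<Rightarrow> ('a \<Rightarrow> 'b::real_normed_vector) set \<Rightarrow> ('a \<Rightarrow> 'b) topology" where
  "uc_topology X S = topology (\<lambda>U. U \<subseteq> S \<and>
     (\<forall>f\<in>U. \<exists>K e. compactin X K \<and> e > 0 \<and> {g\<in>S. \<forall>x\<in>K. norm (g x - f x) < e} \<subseteq> U))"

definition compact_open :: "'a topology \<Rightarrow> 'b topology \<Rightarrow> ('a \<Rightarrow> 'b) set \<Rightarrow> ('a \<Rightarrow> 'b) topology" where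
  "compact_open X Y S = subtopology
     (topology_generated_by (insert S {{f\<in>S. f ` K \<subseteq> W} | K W. compactin X K \<and> openin Y W})) S"

definition dual :: "('k::real_normed_field \<Rightarrow> 'e::{ab_group_add,t2_space} \<Rightarrow> 'e) \<Rightarrow> ('e \<Rightarrow> 'k) set" where
  "dual scE = {l. Vector_Spaces.linear scE (*) l \<and> continuous_on UNIV l}"

definition dual_c :: "('k::real_normed_field \<Rightarrow> 'e::{ab_group_add,t2_space} \<Rightarrow> 'e) \<Rightarrow> ('e \<Rightarrow> 'k) topology" where
  "dual_c scE = uc_topology euclidean (dual scE)"

definition bidual :: "('k::real_normed_field \<Rightarrow> 'e::{ab_group_add,t2_space} \<Rightarrow> 'e) \<Rightarrow> (('e \<Rightarrow> 'k) \<Rightarrow> 'k) set" where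
  "bidual scE = {\<phi>. \<phi> \<in> extensional (dual scE) \<and>
     (\<forall>a\<in>dual scE. \<forall>b\<in>dual scE. \<phi> (\<lambda>x. a x + b x) = \<phi> a + \<phi> b) \<and>
     (\<forall>a\<in>dual scE. \<forall>c. \<phi> (\<lambda>x. c * a x) = c * \<phi> a) \<and>
     continuous_map (dual_c scE) euclidean \<phi>}"

definition bidual_c :: "('k::real_normed_field \<Rightarrow> 'e::{ab_group_add,t2_space} \<Rightarrow> 'e) \<Rightarrow> (('e \<Rightarrow> 'k) \<Rightarrow> 'k) topology" where
  "bidual_c scE = uc_topology (dual_c scE) (bidual scE)"

definition eta :: "('k::real_normed_field \<Rightarrow> 'e::{ab_group_add,t2_space} \<Rightarrow> 'e) \<Rightarrow> 'e \<Rightarrow> ('e \<Rightarrow> 'k) \<Rightarrow> 'k" where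
  "eta scE x = restrict (\<lambda>l. l x) (dual scE)"

definition lc_poisson :: "('k::real_normed_field \<Rightarrow> 'e::{ab_group_add,t2_space} \<Rightarrow> 'e) \<Rightarrow>
    (('e \<Rightarrow> 'k) \<Rightarrow> ('e \<Rightarrow> 'k) \<Rightarrow> ('e \<Rightarrow> 'k)) \<Rightarrow> bool" where
  "lc_poisson scE br \<longleftrightarrow>
     lc_space scE \<and>
     k_infinity_space (euclidean :: 'e topology) \<and>
     embedding_map euclidean (bidual_c scE) (eta scE) \<and>
     \<comment> \<open>bracket: bilinear Lie bracket on E'\<close>
     (\<forall>a\<in>dual scE. \<forall>b\<in>dual scE. br a b \<in> dual scE) \<and>
     (\<forall>a\<in>dual scE. \<forall>b\<in>dual scE. \<forall>c\<in>dual scE.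
        br (\<lambda>x. a x + b x) c = (\<lambda>x. br a c x + br b c x) \<and>
        br c (\<lambda>x. a x + b x) = (\<lambda>x. br c a x + br c b x)) \<and>
     (\<forall>a\<in>dual scE. \<forall>b\<in>dual scE. \<forall>s.
        br (\<lambda>x. s * a x) b = (\<lambda>x. s * br a b x) \<and>
        br a (\<lambda>x. s * b x) = (\<lambda>x. s * br a b x)) \<and>
     (\<forall>a\<in>dual scE. br a a = (\<lambda>x. 0)) \<and>
     (\<forall>a\<in>dual scE. \<forall>b\<in>dual scE. \<forall>c\<in>dual scE.
        (\<lambda>x. br a (br b c) x + br b (br c a) x + br c (br a b) x) = (\<lambda>x. 0)) \<and>
     \<comment> \<open>separate continuity\<close>
     (\<forall>a\<in>dual scE. continuous_map (dual_c scE) (dual_c scE) (br a) \<and>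
                   continuous_map (dual_c scE) (dual_c scE) (\<lambda>b. br b a)) \<and>
     \<comment> \<open>hypocontinuity in the second argument w.r.t. compact sets\<close>
     (\<forall>M W. compactin (dual_c scE) M \<and> openin (dual_c scE) W \<and> (\<lambda>x. 0) \<in> W \<longrightarrow>
        (\<exists>V. openin (dual_c scE) V \<and> (\<lambda>x. 0) \<in> V \<and> (\<forall>v\<in>V. \<forall>m\<in>M. br v m \<in> W))) \<and>
     \<comment> \<open>eta(x) o ad_lambda lies in eta(E)\<close>
     (\<forall>x l. l \<in> dual scE \<longrightarrow> restrict (\<lambda>m. eta scE x (br l m)) (dual scE) \<in> range (eta scE))"

text \<open>Iterated directional derivatives d^k f(x, y_1, ..., y_k), directions stored as ys 0, ..., ys (k-1).\<close>
fun iter_d :: "('k::real_normed_field \<Rightarrow> 'e::{ab_group_add,t2_space} \<Rightarrow> 'e) \<Rightarrow>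
    ('k \<Rightarrow> 'f::{ab_group_add,t2_space} \<Rightarrow> 'f) \<Rightarrow> ('e \<Rightarrow> 'f) \<Rightarrow> nat \<Rightarrow> 'e \<times> (nat \<Rightarrow> 'e) \<Rightarrow> 'f" where
  "iter_d scE scF f 0 = (\<lambda>(x, ys). f x)"
| "iter_d scE scF f (Suc k) = (\<lambda>(x, ys). Lim (at (0::'k))
      (\<lambda>t. scF (inverse t) (iter_d scE scF f k (x + scE t (ys k), ys) - iter_d scE scF f k (x, ys))))"

definition UEk :: "'e::topological_space set \<Rightarrow> nat \<Rightarrow> ('e \<times> (nat \<Rightarrow> 'e)) topology" where
  "UEk U k = prod_topology (subtopology euclidean U) (product_topology (\<lambda>_. euclidean) {..<k})"

text \<open>C^infinity_K(U,F) in Bastiani's sense; functions are normalised to be 0 outside U.\<close>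
definition smooth :: "('k::real_normed_field \<Rightarrow> 'e::{ab_group_add,t2_space} \<Rightarrow> 'e) \<Rightarrow>
    ('k \<Rightarrow> 'f::{ab_group_add,t2_space} \<Rightarrow> 'f) \<Rightarrow> 'e set \<Rightarrow> ('e \<Rightarrow> 'f) set" where
  "smooth scE scF U = {f. (\<forall>x. x \<notin> U \<longrightarrow> f x = 0) \<and>
     (\<forall>k x ys. x \<in> U \<longrightarrow> (\<exists>L. ((\<lambda>t. scF (inverse t)
          (iter_d scE scF f k (x + scE t (ys k), ys) - iter_d scE scF f k (x, ys))) \<longlongrightarrow> L) (at (0::'k)))) \<and>
     (\<forall>k. continuous_map (UEk U k) euclidean (iter_d scE scF f k))}"

definition smooth_top :: "('k::real_normed_field \<Rightarrow> 'e::{ab_group_add,t2_space} \<Rightarrow> 'e) \<Rightarrow>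
    ('k \<Rightarrow> 'f::{ab_group_add,t2_space} \<Rightarrow> 'f) \<Rightarrow> 'e set \<Rightarrow> ('e \<Rightarrow> 'f) topology" where
  "smooth_top scE scF U = subtopology (topology_generated_by
     (insert (smooth scE scF U)
       {{f\<in>smooth scE scF U. restrict (iter_d scE scF f k) (topspace (UEk U k)) \<in> V} | k V.
          openin (compact_open (UEk U k) euclidean
             {g. continuous_map (UEk U k) euclidean g \<and> g \<in> extensional (topspace (UEk U k))}) V}))
     (smooth scE scF U)"

definition hamvf :: "('k::real_normed_field \<Rightarrow> 'e::{ab_group_add,t2_space} \<Rightarrow> 'e) \<Rightarrow>
    (('e \<Rightarrow> 'k) \<Rightarrow> ('e \<Rightarrow> 'k) \<Rightarrow> ('e \<Rightarrow> 'k)) \<Rightarrow> 'e set \<Rightarrow> ('e \<Rightarrow> 'k) \<Rightarrow> 'e \<Rightarrow> 'e" where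
  "hamvf scE br U f x = (if x \<in> U then
     inv (eta scE) (restrict (\<lambda>m. eta scE x (br (\<lambda>y. iter_d scE (*) f 1 (x, \<lambda>_. y)) m)) (dual scE))
     else 0)"

end

theory Submission
  imports Defs
begin

text \<open>Let $\beta(x, \lambda) = \eta^{-1}(\eta(x) \circ \mathrm{ad}_\lambda)$, so that $X_f(x) = \beta(x, f'(x))$.
  The embedding $\eta$ identifies the topology of $E$ with uniform convergence on compact subsets $M$ of $E'_c$,
  and $m(\beta(x, \lambda)) = [\lambda, m](x)$. Hypocontinuity of the bracket makes
  $\beta$ continuous on $K \times E'_c$ for compact $K$, which suffices for the continuity of
  $p \mapsto \beta(c(p), \lambda(p))$ because $U \times E^k$ is a $k$-space. By the product rule,
  the $k$-th derivative of $X_f$ is a sum of $k + 1$ terms $\beta(c, \lambda)$ where $c$ is the base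
  point or a direction and $\lambda$ is a derivative of $f'$; the derivatives of $f'$ converge
  in $E'_c$ by the mean value inequality. The same estimates, applied to the difference
  $m(d^k X_f - d^k X_{f_0})$, give continuity of $f \mapsto X_f$.\<close>

section \<open>Topologies on function spaces\<close>

text \<open>The bracket is only hypocontinuous, so \<beta> need not be jointly continuous on E x
  E'_c. Every estimate therefore uses the splitting m(\<beta>(x, \<lambda>)) - m(\<beta>(x',
  \<lambda>')) = [\<lambda> - \<lambda>', m](x) + ([\<lambda>', m](x) - [\<lambda>', m](x')). The
  first term is small uniformly for m in M and for x in a compact set; the second is small for x
  near x', uniformly in m, because [\<lambda>', M] is again compact in E'_c. Three devices keep x in
  a compact set: null sequences for the difference quotients, compact subsets of the k-space for
  continuity in the point, and the compact sets that define the C^\<infinity>-topology for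
  continuity in f. The mean value inequality is only applied to scalar functions, for each argument
  z of the functional separately; uniformity in z comes from a tube lemma. The base point enters
  \<beta> linearly in its first argument, so at most one of the k directions falls on it and the
  others fall on f'. This gives the k + 1 terms, which involve derivatives of f of order at most k +
  1.\<close>

lemma openin_uc_topology:
  "openin (uc_topology X S) U \<longleftrightarrow> U \<subseteq> S \<and>
     (\<forall>f\<in>U. \<exists>K e. compactin X K \<and> e > 0 \<and> {g\<in>S. \<forall>x\<in>K. norm (g x - f x) < e} \<subseteq> U)"
proof -
  let ?P = "\<lambda>U. U \<subseteq> S \<and>
     (\<forall>f\<in>U. \<exists>K e. compactin X K \<and> e > 0 \<and> {g\<in>S. \<forall>x\<in>K. norm (g x - f x) < e} \<subseteq> U)"
  have "istopology ?P"
    unfolding istopology_def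
  proof (intro conjI allI impI)
    fix A B assume A: "?P A" and B: "?P B"
    show "A \<inter> B \<subseteq> S" using A by auto
    show "\<forall>f\<in>A \<inter> B. \<exists>K e. compactin X K \<and> e > 0 \<and> {g\<in>S. \<forall>x\<in>K. norm (g x - f x) < e} \<subseteq> A \<inter> B"
    proof
      fix f assume f: "f \<in> A \<inter> B"
      obtain K d where K: "compactin X K" "d > 0" "{g\<in>S. \<forall>x\<in>K. norm (g x - f x) < d} \<subseteq> A"
        using A f by auto
      obtain L e where L: "compactin X L" "e > 0" "{g\<in>S. \<forall>x\<in>L. norm (g x - f x) < e} \<subseteq> B"
        using B f by auto
      have "{g\<in>S. \<forall>x\<in>K \<union> L. norm (g x - f x) < min d e} \<subseteq> A \<inter> B"
        using K(3) L(3) by auto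
      then show "\<exists>K e. compactin X K \<and> e > 0 \<and> {g\<in>S. \<forall>x\<in>K. norm (g x - f x) < e} \<subseteq> A \<inter> B"
        using K L compactin_Un by (intro exI[of _ "K \<union> L"] exI[of _ "min d e"]) auto
    qed
  next
    fix \<K> assume K: "\<forall>A\<in>\<K>. ?P A"
    show "\<Union>\<K> \<subseteq> S" using K by auto
    show "\<forall>f\<in>\<Union>\<K>. \<exists>K e. compactin X K \<and> e > 0 \<and> {g\<in>S. \<forall>x\<in>K. norm (g x - f x) < e} \<subseteq> \<Union>\<K>"
      using K by (meson Union_iff Union_upper order_trans)
  qed
  then show ?thesis
    unfolding uc_topology_def by (simp add: topology_inverse')
qed

lemma topspace_uc_topology [simp]: "topspace (uc_topology X S) = S"
proof (rule antisym)
  show "topspace (uc_topology X S) \<subseteq> S"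
    using openin_topspace[of "uc_topology X S"] unfolding openin_uc_topology by (rule conjunct1)
  have "openin (uc_topology X S) S"
    unfolding openin_uc_topology by (auto intro: exI[of _ "{}"] exI[of _ "1::real"])
  then show "S \<subseteq> topspace (uc_topology X S)"
    by (rule openin_subset)
qed

text \<open>On the compact set \<open>K\<close> the continuous function
  \<open>norm (g x - f x)\<close> attains its maximum, which is below \<open>e\<close>; the gap is
  the radius of a ball around \<open>g\<close> that stays inside.\<close>

lemma openin_uc_ball:
  assumes S: "\<And>g. g \<in> S \<Longrightarrow> continuous_map X euclidean g" and f: "f \<in> S" and K: "compactin X K"
  shows "openin (uc_topology X S) {g\<in>S. \<forall>x\<in>K. norm (g x - f x) < e}"
  unfolding openin_uc_topology
proof (intro conjI ballI)
  fix g assume "g \<in> {g\<in>S. \<forall>x\<in>K. norm (g x - f x) < e}"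
  then have g: "g \<in> S" "\<And>x. x \<in> K \<Longrightarrow> norm (g x - f x) < e" by auto
  show "\<exists>K' e'. compactin X K' \<and> e' > 0 \<and> {h\<in>S. \<forall>x\<in>K'. norm (h x - g x) < e'}
           \<subseteq> {g\<in>S. \<forall>x\<in>K. norm (g x - f x) < e}"
  proof (cases "K = {}")
    case True
    then show ?thesis using K by (intro exI[of _ K] exI[of _ 1]) auto
  next
    case False
    have "continuous_map X euclideanreal (\<lambda>x. norm (g x - f x))"
      using S[OF g(1)] S[OF f] by (intro continuous_intros) auto
    then have "compact ((\<lambda>x. norm (g x - f x)) ` K)"
      using image_compactin[OF K] by fastforce
    then obtain x0 where x0: "x0 \<in> K" "\<And>x. x \<in> K \<Longrightarrow> norm (g x - f x) \<le> norm (g x0 - f x0)"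
      using compact_attains_sup[of "(\<lambda>x. norm (g x - f x)) ` K"] False by auto
    define d where "d = e - norm (g x0 - f x0)"
    have "norm (h x - f x) < e" if "x \<in> K" "norm (h x - g x) < d" for h x
      using norm_triangle_ineq[of "h x - g x" "g x - f x"] x0(2)[OF that(1)] that(2)
      by (simp add: d_def)
    then show ?thesis
      using K g(2)[OF x0(1)] by (intro exI[of _ K] exI[of _ d]) (auto simp: d_def)
  qed
qed auto

lemma uc_topology_nhd:
  assumes "openin (uc_topology X S) W" "f \<in> W"
  obtains K e where "compactin X K" "e > 0"
    "\<And>g. g \<in> S \<Longrightarrow> (\<And>x. x \<in> K \<Longrightarrow> norm (g x - f x) < e) \<Longrightarrow> g \<in> W"
proof -
  obtain K e where "compactin X K" "e > 0" "{g\<in>S. \<forall>x\<in>K. norm (g x - f x) < e} \<subseteq> W"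
    using bspec[OF conjunct2[OF iffD1[OF openin_uc_topology assms(1)]] assms(2)] by (elim exE conjE)
  then show thesis by (intro that[of K e]) auto
qed

text \<open>The points where \<open>G\<close> differs by less than \<open>e\<close> from its value
  over \<open>p\<close> form an open set containing \<open>{p} \<times> K\<close>, so the tube lemma
  applies. This turns joint continuity into continuity with respect to uniform convergence on
  compact sets.\<close>

lemma tube_norm:
  fixes G :: "'a \<times> 'b \<Rightarrow> 'c::real_normed_vector"
  assumes G: "continuous_map (prod_topology X Y) euclidean G"
    and p: "p \<in> topspace X" and K: "compactin Y K" and e: "e > 0"
  obtains N where "openin X N" "p \<in> N" "\<And>q z. q \<in> N \<Longrightarrow> z \<in> K \<Longrightarrow> norm (G (q, z) - G (p, z)) < e"
proof -
  let ?H = "\<lambda>w. norm (G w - G (p, snd w))"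
  have "continuous_map (prod_topology X Y) (prod_topology X Y) (\<lambda>w. (p, snd w))"
    using p by (intro continuous_intros) auto
  from continuous_map_compose[OF this G]
  have "continuous_map (prod_topology X Y) euclidean (\<lambda>w. G (p, snd w))"
    by (simp add: o_def)
  then have "continuous_map (prod_topology X Y) euclideanreal ?H"
    using G by (intro continuous_intros)
  then have W: "openin (prod_topology X Y) {w \<in> topspace (prod_topology X Y). ?H w \<in> {..<e}}"
    by (rule openin_continuous_map_preimage) auto
  have "{p} \<times> K \<subseteq> {w \<in> topspace (prod_topology X Y). ?H w \<in> {..<e}}"
    using p e compactin_subset_topspace[OF K] by auto
  from tube_lemma_right[OF W K p this] obtain A B where A: "openin X A" "p \<in> A" "K \<subseteq> B"
    and AB: "A \<times> B \<subseteq> {w \<in> topspace (prod_topology X Y). ?H w \<in> {..<e}}"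
    by (elim exE conjE)
  show thesis
  proof (rule that[of A])
    fix q z assume "q \<in> A" "z \<in> K"
    then have "(q, z) \<in> A \<times> B" using A(3) by auto
    then show "norm (G (q, z) - G (p, z)) < e"
      using AB by auto
  qed (use A in auto)
qed

section \<open>Iterated derivatives of scalar functions\<close>

declare iter_d.simps(2) [simp del]

text \<open>Directions are stored in an infinite sequence of which order \<open>k\<close> reads only
  the first \<open>k\<close> entries. The others may be cut off by \<open>restrict\<close>, as the
  extensional points of \<open>UEk U k\<close> require, or changed at will.\<close>

lemma iter_d_cong:
  assumes "\<And>i. i < k \<Longrightarrow> ys i = ys' i"
  shows "iter_d scE scF f k (x, ys) = iter_d scE scF f k (x, ys')"
  using assms
proof (induction k arbitrary: x)
  case (Suc k)
  have "iter_d scE scF f k (u, ys) = iter_d scE scF f k (u, ys')" for u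
    using Suc.IH Suc.prems by auto
  then show ?case using Suc.prems by (simp add: iter_d.simps(2))
qed simp

section \<open>Differentiation along lines in a locally convex space\<close>

locale lcs =
  fixes scE :: "'k::real_normed_field \<Rightarrow> 'e::{ab_group_add,t2_space} \<Rightarrow> 'e"
  assumes lc: "lc_space scE"
begin

sublocale E: vector_space scE
  using lc by (simp add: lc_space_def)

lemma continuous_map_add:
  assumes "continuous_map X euclidean f" "continuous_map X euclidean g"
  shows "continuous_map X euclidean (\<lambda>p. f p + g p :: 'e)"
proof -
  have *: "continuous_map (euclidean :: ('e \<times> 'e) topology) euclidean (\<lambda>p. fst p + snd p)"
    using lc by (simp add: lc_space_def)
  have "continuous_map X (euclidean :: ('e \<times> 'e) topology) (\<lambda>p. (f p, g p))"
    using assms by (simp only: continuous_map_paired simp_thms flip: prod_topology_euclidean)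
  from continuous_map_compose[OF this *] show ?thesis
    by (simp add: o_def)
qed

lemma continuous_map_scE:
  assumes "continuous_map X euclidean f" "continuous_map X euclidean g"
  shows "continuous_map X euclidean (\<lambda>p. scE (f p) (g p))"
proof -
  have *: "continuous_map (euclidean :: ('k \<times> 'e) topology) euclidean (\<lambda>p. scE (fst p) (snd p))"
    using lc by (simp add: lc_space_def)
  have "continuous_map X (euclidean :: ('k \<times> 'e) topology) (\<lambda>p. (f p, g p))"
    using assms by (simp only: continuous_map_paired simp_thms flip: prod_topology_euclidean)
  from continuous_map_compose[OF this *] show ?thesis
    by (simp add: o_def)
qed

lemma continuous_on_line: "continuous_on UNIV (\<lambda>t. x + scE t y)"
proof -
  have "continuous_map euclidean euclidean (\<lambda>t. x + scE t y)"
    by (intro continuous_map_add continuous_map_scE) auto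
  then show ?thesis by simp
qed

lemma tendsto_line: "((\<lambda>t. x + scE t y) \<longlongrightarrow> x) (at 0)"
proof -
  have "isCont (\<lambda>t. x + scE t y) 0"
    using continuous_on_line by (simp add: continuous_on_eq_continuous_at)
  then show ?thesis by (simp add: isCont_def)
qed

lemma eventually_line:
  assumes "open U" "x \<in> U"
  obtains d where "d > 0" "\<And>t. norm t < d \<Longrightarrow> x + scE t y \<in> U"
proof -
  have "open ((\<lambda>t. x + scE t y) -` U)"
    using continuous_on_line assms(1) by (rule open_vimage[rotated])
  moreover have "0 \<in> (\<lambda>t. x + scE t y) -` U"
    using assms by simp
  ultimately obtain d where "d > 0" "ball 0 d \<subseteq> (\<lambda>t. x + scE t y) -` U"
    using open_contains_ball by blast
  then show thesis
    by (intro that[of d]) (auto simp: subset_iff)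
qed

text \<open>\<open>Lim\<close> is an unspecified value where no limit exists; \<open>smooth\<close>
  supplies existence, and uniqueness of limits then makes the value of \<open>iter_d\<close> the
  actual limit.\<close>

lemma smooth_tendsto:
  assumes "f \<in> smooth scE (*) U" "x \<in> U"
  shows "((\<lambda>t. inverse t * (iter_d scE (*) f k (x + scE t (ys k), ys) - iter_d scE (*) f k (x, ys)))
     \<longlongrightarrow> (iter_d scE (*) f (Suc k) (x, ys) :: 'k)) (at 0)"
proof -
  obtain L where "((\<lambda>t. inverse t * (iter_d scE (*) f k (x + scE t (ys k), ys) - iter_d scE (*) f k (x, ys)))
     \<longlongrightarrow> L) (at 0)"
    using assms unfolding smooth_def by blast
  then show ?thesis
    by (simp add: tendsto_Lim iter_d.simps(2))
qed

lemma smooth_continuous: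
  assumes f: "f \<in> smooth scE scF U" and a: "continuous_map X (subtopology euclidean U) a"
    and b: "\<And>i. i < k \<Longrightarrow> continuous_map X euclidean (\<lambda>p. b p i)"
  shows "continuous_map X euclidean (\<lambda>p. iter_d scE scF f k (a p, b p))"
proof -
  have "continuous_map X (UEk U k) (\<lambda>p. (a p, restrict (b p) {..<k}))"
    unfolding UEk_def using a b
    by (auto simp: continuous_map_paired continuous_map_componentwise)
  moreover have "continuous_map (UEk U k) euclidean (iter_d scE scF f k)"
    using f by (simp add: smooth_def)
  ultimately have "continuous_map X euclidean (iter_d scE scF f k \<circ> (\<lambda>p. (a p, restrict (b p) {..<k})))"
    by (rule continuous_map_compose)
  then have "continuous_map X euclidean (\<lambda>p. iter_d scE scF f k (a p, restrict (b p) {..<k}))"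
    by (simp add: o_def)
  moreover have "iter_d scE scF f k (a p, restrict (b p) {..<k}) = iter_d scE scF f k (a p, b p)" for p
    by (rule iter_d_cong) auto
  ultimately show ?thesis by simp
qed

text \<open>Passes from the derivative over \<open>'k\<close> to a real derivative along a segment.
  An increment \<open>h\<close> of \<open>s\<close> is an increment \<open>h * t\<close> of the
  scalar, whence the factor \<open>t\<close>; for \<open>t \<noteq> 0\<close> it tends to 0 through
  nonzero scalars.\<close>

lemma has_vector_derivative_line:
  assumes f: "f \<in> smooth scE (*) U" and x: "a + scE (of_real s * t) (zs k) \<in> U" and t: "t \<noteq> 0"
  shows "((\<lambda>s. iter_d scE (*) f k (a + scE (of_real s * t) (zs k), zs)) has_vector_derivative
          t * iter_d scE (*) f (Suc k) (a + scE (of_real s * t) (zs k), zs)) (at s)"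
proof -
  let ?F = "\<lambda>x. iter_d scE (*) f k (x, zs)" and ?x = "a + scE (of_real s * t) (zs k)"
  let ?D = "iter_d scE (*) f (Suc k) (?x, zs)"
  have lim: "filterlim (\<lambda>h. of_real h * t) (at 0) (at (0::real))"
  proof (rule filterlim_atI)
    have "((\<lambda>h. of_real h * t) \<longlongrightarrow> of_real 0 * t) (at (0::real))"
      by (intro tendsto_intros)
    then show "((\<lambda>h. of_real h * t) \<longlongrightarrow> 0) (at (0::real))" by simp
    show "\<forall>\<^sub>F h in at (0::real). of_real h * t \<noteq> 0"
      using t by (auto simp: eventually_at_filter)
  qed
  have "((\<lambda>h. inverse (of_real h * t) * (?F (?x + scE (of_real h * t) (zs k)) - ?F ?x)) \<longlongrightarrow> ?D) (at (0::real))"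
    using filterlim_compose[OF smooth_tendsto[OF f x, of k zs] lim] .
  then have "((\<lambda>h. t * (inverse (of_real h * t) * (?F (?x + scE (of_real h * t) (zs k)) - ?F ?x))) \<longlongrightarrow> t * ?D) (at (0::real))"
    by (rule tendsto_mult_left)
  then have "((\<lambda>h. t * (inverse (of_real h * t) * (?F (?x + scE (of_real h * t) (zs k)) - ?F ?x)) - t * ?D) \<longlongrightarrow> 0) (at (0::real))"
    using tendsto_diff[OF _ tendsto_const[of "t * ?D"]] by force
  then have *: "((\<lambda>h. norm (t * (inverse (of_real h * t) * (?F (?x + scE (of_real h * t) (zs k)) - ?F ?x)) - t * ?D)) \<longlongrightarrow> 0) (at (0::real))"
    by (rule tendsto_norm_zero)
  have "\<forall>\<^sub>F h in at (0::real). norm (t * (inverse (of_real h * t) * (?F (?x + scE (of_real h * t) (zs k)) - ?F ?x)) - t * ?D)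
     = norm (?F (a + scE (of_real (s + h) * t) (zs k)) - ?F ?x - h *\<^sub>R (t * ?D)) / norm h"
  proof -
    have "norm (t * (inverse (of_real h * t) * (?F (?x + scE (of_real h * t) (zs k)) - ?F ?x)) - t * ?D)
     = norm (?F (a + scE (of_real (s + h) * t) (zs k)) - ?F ?x - h *\<^sub>R (t * ?D)) / norm h" if "h \<noteq> 0" for h :: real
    proof -
      have "a + scE (of_real (s + h) * t) (zs k) = ?x + scE (of_real h * t) (zs k)"
        by (simp add: E.scale_left_distrib algebra_simps)
      moreover have "t * (inverse (of_real h * t) * A) - t * ?D = inverse (of_real h) * (A - h *\<^sub>R (t * ?D))" for A
        using that t by (simp add: field_simps scaleR_conv_of_real)
      ultimately have "norm (t * (inverse (of_real h * t) * (?F (?x + scE (of_real h * t) (zs k)) - ?F ?x)) - t * ?D)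
        = norm (inverse (of_real h :: 'k)) * norm (?F (a + scE (of_real (s + h) * t) (zs k)) - ?F ?x - h *\<^sub>R (t * ?D))"
        by (simp only: norm_mult)
      then show ?thesis
        by (simp add: norm_inverse divide_inverse)
    qed
    then show ?thesis by (auto simp: eventually_at_filter)
  qed
  from Lim_transform_eventually[OF * this] show ?thesis
    unfolding has_vector_derivative_def has_derivative_at
    by (simp add: bounded_linear_scaleR_left)
qed

text \<open>Subtracting the linear function \<open>s *\<^sub>R (t * c)\<close> turns closeness of
  the derivative to \<open>c\<close> into a derivative of norm at most \<open>norm t * e\<close>, to
  which the real mean value inequality on [0, 1] applies.\<close>

lemma mean_value:
  assumes f: "f \<in> smooth scE (*) U"
    and seg: "\<And>s. 0 \<le> s \<Longrightarrow> s \<le> 1 \<Longrightarrow> a + scE (of_real s * t) (zs k) \<in> U"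
    and bd: "\<And>s. 0 \<le> s \<Longrightarrow> s \<le> 1 \<Longrightarrow>
      norm (iter_d scE (*) f (Suc k) (a + scE (of_real s * t) (zs k), zs) - c) \<le> e"
  shows "norm (iter_d scE (*) f k (a + scE t (zs k), zs) - iter_d scE (*) f k (a, zs) - t * c) \<le> norm t * e"
proof (cases "t = 0")
  case False
  let ?x = "\<lambda>s. a + scE (of_real s * t) (zs k)"
  let ?h = "\<lambda>s. iter_d scE (*) f k (?x s, zs) - s *\<^sub>R (t * c)"
  have der: "(?h has_vector_derivative (t * iter_d scE (*) f (Suc k) (?x s, zs) - t * c)) (at s)"
    if "0 \<le> s" "s \<le> 1" for s
    using has_vector_derivative_line[of f U a s t zs k, OF f seg[OF that] False]
    by (intro has_vector_derivative_diff) (auto intro!: derivative_eq_intros)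
  have "norm (?h 1 - ?h 0) \<le> (norm t * e) * 1 - (norm t * e) * 0"
  proof (rule differentiable_bound_general[where f = ?h and \<phi> = "\<lambda>s. (norm t * e) * s"])
    show "continuous_on {0..1} ?h"
      using der by (intro continuous_at_imp_continuous_on ballI has_vector_derivative_continuous) auto
    show "(?h has_vector_derivative (t * iter_d scE (*) f (Suc k) (?x s, zs) - t * c)) (at s)"
      if "0 < s" "s < 1" for s
      using der that by auto
    show "((\<lambda>s. (norm t * e) * s) has_vector_derivative (norm t * e)) (at s)" for s
      by (auto intro!: derivative_eq_intros)
    show "norm (t * iter_d scE (*) f (Suc k) (?x s, zs) - t * c) \<le> norm t * e" if "0 < s" "s < 1" for s
    proof -
      have "norm (t * iter_d scE (*) f (Suc k) (?x s, zs) - t * c)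
          = norm t * norm (iter_d scE (*) f (Suc k) (?x s, zs) - c)"
        by (simp add: right_diff_distrib flip: norm_mult)
      then show ?thesis
        using bd[of s] that by (simp add: mult_left_mono)
    qed
  qed (auto intro!: continuous_intros)
  then show ?thesis by (simp add: algebra_simps)
qed simp

section \<open>Derivatives with values in the dual\<close>

lemma tendsto_E_add:
  assumes "(f \<longlongrightarrow> a) F" "(g \<longlongrightarrow> b) F"
  shows "((\<lambda>t. f t + g t :: 'e) \<longlongrightarrow> a + b) F"
proof -
  have "continuous_on UNIV (\<lambda>p::'e \<times> 'e. fst p + snd p)"
    using lc by (simp add: lc_space_def)
  then have "isCont (\<lambda>p::'e \<times> 'e. fst p + snd p) (a, b)"
    by (simp add: continuous_on_eq_continuous_at)
  from isCont_tendsto_compose[OF this tendsto_Pair[OF assms]] show ?thesis by simp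
qed

lemma tendsto_E_sum:
  assumes "\<And>i. i \<in> I \<Longrightarrow> ((\<lambda>t. f i t) \<longlongrightarrow> (a i :: 'e)) F"
  shows "((\<lambda>t. \<Sum>i\<in>I. f i t) \<longlongrightarrow> (\<Sum>i\<in>I. a i)) F"
  using assms by (induction I rule: infinite_finite_induct) (auto intro: tendsto_E_add)

lemma continuous_map_E_sum:
  assumes "\<And>i. i \<in> I \<Longrightarrow> continuous_map X euclidean (\<lambda>p. f i p :: 'e)"
  shows "continuous_map X euclidean (\<lambda>p. \<Sum>i\<in>I. f i p)"
  using assms by (induction I rule: infinite_finite_induct) (auto intro: continuous_map_add)

lemma mem_dual:
  "l \<in> dual scE \<longleftrightarrow> (\<forall>x y. l (x + y) = l x + l y) \<and> (\<forall>c x. l (scE c x) = c * l x) \<and>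
     continuous_on UNIV l"
  unfolding dual_def Vector_Spaces.linear_def module_hom_def module_hom_axioms_def
  using E.vector_space_axioms E.module_axioms vector_space_over_itself.vector_space_axioms
    vector_space_over_itself.module_axioms by auto

lemma dual_add: "l \<in> dual scE \<Longrightarrow> l (x + y) = l x + l y"
  and dual_scale: "l \<in> dual scE \<Longrightarrow> l (scE c x) = c * l x"
  by (simp_all add: mem_dual)

lemma dual_zero: "l \<in> dual scE \<Longrightarrow> l 0 = 0"
  using dual_scale[of l 0 0] by simp

lemma dual_diff: "l \<in> dual scE \<Longrightarrow> l (x - y) = l x - l y"
  using dual_add[of l "x - y" y] by simp

lemma dual_sum: "l \<in> dual scE \<Longrightarrow> l (\<Sum>i\<in>I. g i) = (\<Sum>i\<in>I. l (g i))"
  by (induction I rule: infinite_finite_induct) (auto simp: dual_add dual_zero)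

lemma zero_in_dual: "(\<lambda>x. 0) \<in> dual scE"
  and add_in_dual: "a \<in> dual scE \<Longrightarrow> b \<in> dual scE \<Longrightarrow> (\<lambda>x. a x + b x) \<in> dual scE"
  and scale_in_dual: "a \<in> dual scE \<Longrightarrow> (\<lambda>x. c * a x) \<in> dual scE"
  by (simp_all add: mem_dual distrib_left mult.left_commute continuous_on_add continuous_on_mult_left)

lemma diff_in_dual: "a \<in> dual scE \<Longrightarrow> b \<in> dual scE \<Longrightarrow> (\<lambda>x. a x - b x) \<in> dual scE"
  using add_in_dual[of a "\<lambda>x. - 1 * b x"] scale_in_dual[of b "- 1"] by simp

lemma dual_continuous_map: "l \<in> dual scE \<Longrightarrow> continuous_map euclidean euclidean l"
  by (simp add: mem_dual)

lemma openin_dual_c_ball: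
  assumes "f \<in> dual scE" "compact K"
  shows "openin (dual_c scE) {g\<in>dual scE. \<forall>x\<in>K. norm (g x - f x) < e}"
  unfolding dual_c_def using assms by (intro openin_uc_ball dual_continuous_map) auto

lemma dual_c_zero_nhd:
  assumes "openin (dual_c scE) V" "(\<lambda>x. 0) \<in> V"
  obtains K e where "compact K" "e > 0" "\<And>g. g \<in> dual scE \<Longrightarrow> (\<And>x. x \<in> K \<Longrightarrow> norm (g x) < e) \<Longrightarrow> g \<in> V"
  using assms unfolding dual_c_def by (elim uc_topology_nhd) auto

lemma topspace_dual_c [simp]: "topspace (dual_c scE) = dual scE"
  by (simp add: dual_c_def)

lemma compactin_dual_c_subset: "compactin (dual_c scE) M \<Longrightarrow> m \<in> M \<Longrightarrow> m \<in> dual scE"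
  using compactin_subset_topspace by fastforce

text \<open>The $k$-th derivative of $f' \colon U \to E'$ in the directions \<open>ys\<close>. The first direction
  of the derivative of $f$ of order $k + 1$ is the argument of the functional.\<close>

definition ddual :: "('e \<Rightarrow> 'k) \<Rightarrow> nat \<Rightarrow> 'e \<Rightarrow> (nat \<Rightarrow> 'e) \<Rightarrow> 'e \<Rightarrow> 'k" where
  "ddual f k x ys = (\<lambda>z. iter_d scE (*) f (Suc k) (x, case_nat z ys))"

lemma ddual_cong: "(\<And>i. i < k \<Longrightarrow> ys i = ys' i) \<Longrightarrow> ddual f k x ys = ddual f k x ys'"
  unfolding ddual_def by (intro ext iter_d_cong) (auto split: nat.splits)

text \<open>The direction in slot 0 is differentiated first and later slots are applied outside, so
  with \<open>z\<close> in slot 0 the next derivative is taken in direction \<open>ys k\<close> at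
  fixed \<open>z\<close>. No symmetry of higher derivatives enters.\<close>

lemma ddual_tendsto:
  assumes "f \<in> smooth scE (*) U" "x \<in> U"
  shows "((\<lambda>t. inverse t * (ddual f k (x + scE t (ys k)) ys z - ddual f k x ys z))
     \<longlongrightarrow> ddual f (Suc k) x ys z) (at 0)"
  using smooth_tendsto[OF assms, of "Suc k" "case_nat z ys"] by (simp add: ddual_def)

lemma continuous_map_iter_d_case_nat:
  assumes f: "f \<in> smooth scE scF U" and a: "continuous_map X (subtopology euclidean U) a"
    and b: "\<And>i. i < k \<Longrightarrow> continuous_map X euclidean (\<lambda>p. b p i)"
  shows "continuous_map (prod_topology X euclidean) euclidean
     (\<lambda>(p, z). iter_d scE scF f (Suc k) (a p, case_nat z (b p)))"
proof -
  have fst: "continuous_map (prod_topology X euclidean) Y (\<lambda>w. g (fst w))"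
    if "continuous_map X Y g" for g :: "_ \<Rightarrow> 'z" and Y
    using continuous_map_compose[OF continuous_map_fst that] by (simp add: o_def)
  have "continuous_map (prod_topology X euclidean) euclidean
      (\<lambda>w. iter_d scE scF f (Suc k) (a (fst w), case_nat (snd w) (b (fst w))))"
  proof (rule smooth_continuous[OF f fst[OF a]])
    fix i assume "i < Suc k"
    then show "continuous_map (prod_topology X euclidean) euclidean (\<lambda>w. case_nat (snd w) (b (fst w)) i)"
      using fst[OF b] by (cases i) (auto intro: continuous_map_snd)
  qed
  then show ?thesis by (simp add: case_prod_unfold)
qed

text \<open>Continuity of the derivatives of f' as maps into E'_c, obtained from joint continuity in
  the point and the argument \<open>z\<close> by \<open>tube_norm\<close>.\<close>

lemma ddual_nhd:
  assumes f: "f \<in> smooth scE (*) U" and a: "continuous_map X (subtopology euclidean U) a"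
    and b: "\<And>i. i < k \<Longrightarrow> continuous_map X euclidean (\<lambda>p. b p i)"
    and p: "p \<in> topspace X" and K: "compact K" and e: "e > 0"
  obtains N where "openin X N" "p \<in> N"
    "\<forall>q\<in>N. \<forall>z\<in>K. norm (ddual f k (a q) (b q) z - ddual f k (a p) (b p) z) < e"
proof -
  have G: "continuous_map (prod_topology X euclidean) euclidean
      (\<lambda>(p, z). iter_d scE (*) f (Suc k) (a p, case_nat z (b p)))"
    by (rule continuous_map_iter_d_case_nat[OF f a b])
  have K': "compactin euclidean K" using K by simp
  show thesis
    by (rule tube_norm[OF G p K' e], rule that) (auto simp: ddual_def)
qed

text \<open>In \<open>Q (y + z) t - Q y t\<close> only the increment of \<open>f\<close> from
  \<open>x + scE t y\<close> in direction \<open>z\<close> survives. The mean value inequality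
  compares it with the derivative at \<open>x\<close>, since the derivative in direction
  \<open>z\<close> is continuous.\<close>

lemma ddual_zero_add:
  assumes U: "open U" and f: "f \<in> smooth scE (*) U" and x: "x \<in> U"
  shows "ddual f 0 x ys (y + z) = ddual f 0 x ys y + ddual f 0 x ys z"
proof -
  let ?D = "\<lambda>x z. iter_d scE (*) f (Suc 0) (x, \<lambda>_. z)"
  have eq: "ddual f 0 x ys z = ?D x z" for z
    unfolding ddual_def by (rule iter_d_cong) simp
  define Q where "Q = (\<lambda>z t. inverse t * (f (x + scE t z) - f x))"
  have Q: "(Q z \<longlongrightarrow> ?D x z) (at 0)" for z
    using smooth_tendsto[OF f x, of 0 "\<lambda>_. z"] by (simp add: Q_def)
  \<comment> \<open>Two independent scalars are needed: the segment from \<open>x + scE t y\<close>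
    consists of points with scalars \<open>t\<close> and \<open>s * t\<close>, and a product
    neighbourhood of (0, 0) contains all of these pairs.\<close>
  define P where "P w = x + scE (fst w) y + scE (snd w) z" for w
  have P: "continuous_map (euclidean :: ('k \<times> 'k) topology) euclidean P"
    unfolding P_def by (intro continuous_map_add continuous_map_scE) (auto intro!: continuous_intros)
  define W where "W = P -` U"
  have W: "open W" "(0, 0) \<in> W"
    using P U x by (auto simp: W_def P_def intro: open_vimage)
  have "continuous_map (subtopology euclidean W) (subtopology euclidean U) P"
    using P by (auto simp: continuous_map_in_subtopology W_def continuous_map_from_subtopology simp del: continuous_map_iff_continuous)
  then have G: "continuous_map (subtopology euclidean W) euclidean (\<lambda>w. ?D (P w) z)"
    by (intro smooth_continuous[OF f]) auto
  have "((\<lambda>t. Q (y + z) t - Q y t - ?D x z) \<longlongrightarrow> 0) (at 0)"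
    unfolding tendsto_iff
  proof (intro allI impI)
    fix e :: real assume e: "e > 0"
    \<comment> \<open>The radius \<open>e / 2\<close> makes room for a strict bound, since the mean
      value inequality is not strict.\<close>
    have "openin (subtopology euclidean W) {w \<in> topspace (subtopology euclidean W). ?D (P w) z \<in> ball (?D x z) (e / 2)}"
      using G by (rule openin_continuous_map_preimage) auto
    then have V: "open {w \<in> W. ?D (P w) z \<in> ball (?D x z) (e / 2)}"
      using W(1) by (simp add: openin_open_eq)
    have "(0, 0) \<in> {w \<in> W. ?D (P w) z \<in> ball (?D x z) (e / 2)}"
      using W(2) e by (simp add: P_def)
    then obtain A B where A: "open A" "open B" "(0, 0) \<in> A \<times> B"
      and AB: "A \<times> B \<subseteq> {w \<in> W. ?D (P w) z \<in> ball (?D x z) (e / 2)}"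
      by (rule open_prod_elim[OF V])
    have "open (A \<inter> B)" "0 \<in> A \<inter> B"
      using A by auto
    then obtain d where d: "d > 0" "ball 0 d \<subseteq> A \<inter> B"
      by (meson open_contains_ball)
    have "dist (Q (y + z) t - Q y t - ?D x z) 0 < e" if t: "t \<noteq> 0" "norm t < d" for t
    proof -
      let ?a = "x + scE t y"
      have near: "?a + scE (of_real s * t) z \<in> U"
        "norm (?D (?a + scE (of_real s * t) z) z - ?D x z) \<le> e / 2" if "0 \<le> s" "s \<le> 1" for s
      proof -
        have "norm (of_real s * t) \<le> norm t"
          using that by (simp add: norm_mult mult_left_le_one_le)
        then have "(t, of_real s * t) \<in> A \<times> B"
          using d(2) t by (auto simp: subset_iff)
        then have "(t, of_real s * t) \<in> W"  "?D (P (t, of_real s * t)) z \<in> ball (?D x z) (e / 2)"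
          using AB by auto
        then show "?a + scE (of_real s * t) z \<in> U"
          "norm (?D (?a + scE (of_real s * t) z) z - ?D x z) \<le> e / 2"
          by (auto simp: W_def P_def dist_norm norm_minus_commute)
      qed
      have "norm (f (?a + scE t z) - f ?a - t * ?D x z) \<le> norm t * (e / 2)"
        using mean_value[OF f, where a = ?a and zs = "\<lambda>_. z" and k = 0 and t = t and c = "?D x z" and e = "e / 2"]
          near by simp
      moreover have "Q (y + z) t - Q y t - ?D x z = inverse t * (f (?a + scE t z) - f ?a - t * ?D x z)"
        using t(1) by (simp add: Q_def algebra_simps E.scale_right_distrib)
      ultimately have "norm (Q (y + z) t - Q y t - ?D x z) \<le> inverse (norm t) * (norm t * (e / 2))"
        by (simp only: norm_mult norm_inverse) (intro mult_left_mono, auto)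
      also have "\<dots> < e" using t e by simp
      finally show ?thesis by simp
    qed
    then show "\<forall>\<^sub>F t in at 0. dist (Q (y + z) t - Q y t - ?D x z) 0 < e"
      using d(1) by (auto simp: eventually_at dist_norm)
  qed
  moreover have "((\<lambda>t. Q (y + z) t - Q y t - ?D x z) \<longlongrightarrow> ?D x (y + z) - ?D x y - ?D x z) (at 0)"
    by (intro tendsto_intros Q)
  ultimately have "?D x (y + z) - ?D x y - ?D x z = 0"
    by (intro tendsto_unique) auto
  then show ?thesis by (simp add: eq algebra_simps)
qed

lemma ddual_zero_scale:
  assumes f: "f \<in> smooth scE (*) U" and x: "x \<in> U"
  shows "ddual f 0 x ys (scE c z) = c * ddual f 0 x ys z"
proof -
  let ?D = "\<lambda>x z. iter_d scE (*) f (Suc 0) (x, \<lambda>_. z)"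
  have eq: "ddual f 0 x ys z = ?D x z" for z
    unfolding ddual_def by (rule iter_d_cong) simp
  define Q where "Q = (\<lambda>z t. inverse t * (f (x + scE t z) - f x))"
  have Q: "(Q z \<longlongrightarrow> ?D x z) (at 0)" for z
    using smooth_tendsto[OF f x, of 0 "\<lambda>_. z"] by (simp add: Q_def)
  have "?D x (scE c z) = c * ?D x z"
  proof (cases "c = 0")
    case True
    have "(Q (scE c z) \<longlongrightarrow> 0) (at 0)"
      using True by (simp add: Q_def)
    from tendsto_unique[OF _ Q[of "scE c z"] this] show ?thesis using True by simp
  next
    case False
    \<comment> \<open>Substitution of \<open>t * c\<close> for \<open>t\<close> in the difference
      quotient. It needs \<open>c \<noteq> 0\<close>, because \<open>t * c\<close> must approach 0
      through nonzero scalars.\<close>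
    have "((\<lambda>t. t * c) \<longlongrightarrow> 0 * c) (at 0)"
      by (intro tendsto_intros)
    then have "filterlim (\<lambda>t. t * c) (at 0) (at 0)"
      using False by (intro filterlim_atI) (auto simp: eventually_at_filter)
    from filterlim_compose[OF Q this]
    have "((\<lambda>t. c * Q z (t * c)) \<longlongrightarrow> c * ?D x z) (at 0)"
      by (rule tendsto_mult_left)
    moreover have "(\<lambda>t. c * Q z (t * c)) = Q (scE c z)"
      using False by (simp add: Q_def fun_eq_iff)
    ultimately have "(Q (scE c z) \<longlongrightarrow> c * ?D x z) (at 0)" by simp
    from tendsto_unique[OF _ Q[of "scE c z"] this] show ?thesis by simp
  qed
  then show ?thesis by (simp add: eq)
qed

text \<open>Linearity passes to pointwise limits of difference quotients, so it propagates from the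
  first derivative. The base point varies in the induction because the quotient also involves
  \<open>x + scE t (ys k)\<close>.\<close>

lemma ddual_linear:
  assumes U: "open U" and f: "f \<in> smooth scE (*) U" and x: "x \<in> U"
  shows "ddual f k x ys (y + z) = ddual f k x ys y + ddual f k x ys z"
    and "ddual f k x ys (scE c z) = c * ddual f k x ys z"
proof -
  have "ddual f k x ys (y + z) = ddual f k x ys y + ddual f k x ys z
      \<and> ddual f k x ys (scE c z) = c * ddual f k x ys z"
    using x
  proof (induction k arbitrary: x)
    case 0
    then show ?case using ddual_zero_add[OF U f] ddual_zero_scale[OF f] by auto
  next
    case (Suc k)
    let ?q = "\<lambda>z t. inverse t * (ddual f k (x + scE t (ys k)) ys z - ddual f k x ys z)"
    have q: "(?q z \<longlongrightarrow> ddual f (Suc k) x ys z) (at 0)" for z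
      using ddual_tendsto[OF f Suc.prems] .
    obtain d where d: "d > 0" "\<And>t. norm t < d \<Longrightarrow> x + scE t (ys k) \<in> U"
      using eventually_line[OF U Suc.prems, where y = "ys k"] by blast
    have ev: "\<forall>\<^sub>F t in at 0. x + scE t (ys k) \<in> U"
      using d by (auto simp: eventually_at dist_norm)
    have "\<forall>\<^sub>F t in at 0. ?q y t + ?q z t = ?q (y + z) t"
    proof (rule eventually_mono[OF ev])
      fix t assume "x + scE t (ys k) \<in> U"
      from Suc.IH[OF this] Suc.IH[OF Suc.prems] show "?q y t + ?q z t = ?q (y + z) t"
        by (simp add: right_diff_distrib distrib_left)
    qed
    moreover have "\<forall>\<^sub>F t in at 0. c * ?q z t = ?q (scE c z) t"
    proof (rule eventually_mono[OF ev])
      fix t assume "x + scE t (ys k) \<in> U"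
      from Suc.IH[OF this] Suc.IH[OF Suc.prems] show "c * ?q z t = ?q (scE c z) t"
        by (simp add: right_diff_distrib mult.left_commute)
    qed
    moreover have "((\<lambda>t. ?q y t + ?q z t) \<longlongrightarrow> ddual f (Suc k) x ys y + ddual f (Suc k) x ys z) (at 0)"
      "((\<lambda>t. c * ?q z t) \<longlongrightarrow> c * ddual f (Suc k) x ys z) (at 0)"
      by (intro tendsto_intros q)+
    ultimately have "(?q (y + z) \<longlongrightarrow> ddual f (Suc k) x ys y + ddual f (Suc k) x ys z) (at 0)"
      "(?q (scE c z) \<longlongrightarrow> c * ddual f (Suc k) x ys z) (at 0)"
      by (blast intro: Lim_transform_eventually)+
    with q[of "y + z"] q[of "scE c z"] show ?case
      using tendsto_unique[OF trivial_limit_at] by blast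
  qed
  then show "ddual f k x ys (y + z) = ddual f k x ys y + ddual f k x ys z"
    "ddual f k x ys (scE c z) = c * ddual f k x ys z" by auto
qed

lemma ddual_in_dual:
  assumes U: "open U" and f: "f \<in> smooth scE (*) U" and x: "x \<in> U"
  shows "ddual f k x ys \<in> dual scE"
proof -
  have "continuous_map euclidean euclidean (\<lambda>z. iter_d scE (*) f (Suc k) (x, case_nat z ys))"
  proof (rule smooth_continuous[OF f])
    show "continuous_map euclidean euclidean (\<lambda>z. case_nat z ys i)" for i
      by (cases i) auto
  qed (use x in auto)
  then have "continuous_on UNIV (ddual f k x ys)"
    by (simp add: ddual_def)
  then show ?thesis
    using ddual_linear[OF U f x] by (simp add: mem_dual)
qed

text \<open>Differentiability of f' and its derivatives as maps into E'_c, not merely pointwise. The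
  mean value inequality is used for each \<open>z\<close> with its own constant; only the bound
  along the segment has to be uniform in \<open>z\<close>, and \<open>ddual_nhd\<close> gives
  that.\<close>

lemma ddual_diff_quotient_uniform:
  assumes U: "open U" and f: "f \<in> smooth scE (*) U" and x: "x \<in> U" and K: "compact K" and e: "e > 0"
  shows "\<forall>\<^sub>F t in at 0. \<forall>z\<in>K.
    norm (inverse t * (ddual f k (x + scE t (ys k)) ys z - ddual f k x ys z) - ddual f (Suc k) x ys z) < e"
proof -
  obtain d where d: "d > 0" "\<And>t. norm t < d \<Longrightarrow> x + scE t (ys k) \<in> U"
    using eventually_line[OF U x, where y = "ys k"] by blast
  have "continuous_map (subtopology euclidean (ball 0 d)) (subtopology euclidean U) (\<lambda>t. x + scE t (ys k))"
    using continuous_on_line d(2) by (auto simp: continuous_map_in_subtopology intro: continuous_on_subset)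
  from ddual_nhd[OF f this, where b = "\<lambda>_. ys" and k = "Suc k" and p = 0 and K = K and e = "e / 2"]
  obtain N where N: "openin (subtopology euclidean (ball 0 d)) N" "0 \<in> N"
    "\<forall>u\<in>N. \<forall>z\<in>K.
       norm (ddual f (Suc k) (x + scE u (ys k)) ys z - ddual f (Suc k) x ys z) < e / 2"
    using K e d(1) by auto
  then have "open N" using openin_open_eq[of "ball 0 d" N] by auto
  then obtain r where r: "r > 0" "ball 0 r \<subseteq> N"
    using N(2) open_contains_ball by blast
  have "norm (inverse t * (ddual f k (x + scE t (ys k)) ys z - ddual f k x ys z) - ddual f (Suc k) x ys z) < e"
    if t: "t \<noteq> 0" "norm t < r" "norm t < d" and z: "z \<in> K" for t z
  proof -
    let ?c = "ddual f (Suc k) x ys z" and ?A = "ddual f k (x + scE t (ys k)) ys z - ddual f k x ys z"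
    have *: "norm (of_real s * t) \<le> norm t" if "0 \<le> s" "s \<le> 1" for s
      using that by (simp add: norm_mult mult_left_le_one_le)
    let ?zs = "case_nat z ys"
    have "norm (iter_d scE (*) f (Suc k) (x + scE t (?zs (Suc k)), ?zs) - iter_d scE (*) f (Suc k) (x, ?zs)
        - t * ?c) \<le> norm t * (e / 2)"
    proof (rule mean_value[OF f])
      fix s :: real assume s: "0 \<le> s" "s \<le> 1"
      show "x + scE (of_real s * t) (?zs (Suc k)) \<in> U"
        using d(2) *[OF s] t by simp
      have "of_real s * t \<in> N"
        using r(2) *[OF s] t by (auto simp: subset_iff)
      from N(3)[rule_format, OF this z]
      show "norm (iter_d scE (*) f (Suc (Suc k)) (x + scE (of_real s * t) (?zs (Suc k)), ?zs) - ?c) \<le> e / 2"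
        by (simp add: ddual_def)
    qed
    then have "norm (?A - t * ?c) \<le> norm t * (e / 2)"
      by (simp add: ddual_def)
    moreover have "inverse t * ?A - ?c = inverse t * (?A - t * ?c)"
      using t(1) by (simp add: algebra_simps)
    ultimately have "norm (inverse t * ?A - ?c) \<le> inverse (norm t) * (norm t * (e / 2))"
      by (simp only: norm_mult norm_inverse) (intro mult_left_mono, auto)
    also have "\<dots> < e" using t e by simp
    finally show ?thesis .
  qed
  then show ?thesis
    using r(1) d(1) unfolding eventually_at by (intro exI[of _ "min r d"]) (auto simp: dist_norm)
qed

end

section \<open>Poisson vector spaces\<close>

locale poisson_space =
  fixes scE :: "'k::real_normed_field \<Rightarrow> 'e::{ab_group_add,t2_space} \<Rightarrow> 'e"
    and br :: "('e \<Rightarrow> 'k) \<Rightarrow> ('e \<Rightarrow> 'k) \<Rightarrow> ('e \<Rightarrow> 'k)"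
  assumes poisson: "lc_poisson scE br"
begin

sublocale lcs scE
  using poisson by unfold_locales (simp add: lc_poisson_def)

lemma k_infinity: "k_infinity_space (euclidean :: 'e topology)"
  and embedding: "embedding_map euclidean (bidual_c scE) (eta scE)"
  and br_in_dual: "\<forall>a\<in>dual scE. \<forall>b\<in>dual scE. br a b \<in> dual scE"
  and br_add: "\<forall>a\<in>dual scE. \<forall>b\<in>dual scE. \<forall>c\<in>dual scE.
        br (\<lambda>x. a x + b x) c = (\<lambda>x. br a c x + br b c x) \<and>
        br c (\<lambda>x. a x + b x) = (\<lambda>x. br c a x + br c b x)"
  and br_scale: "\<forall>a\<in>dual scE. \<forall>b\<in>dual scE. \<forall>s.
        br (\<lambda>x. s * a x) b = (\<lambda>x. s * br a b x) \<and>
        br a (\<lambda>x. s * b x) = (\<lambda>x. s * br a b x)"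
  and br_separately_continuous: "\<forall>a\<in>dual scE. continuous_map (dual_c scE) (dual_c scE) (br a) \<and>
                   continuous_map (dual_c scE) (dual_c scE) (\<lambda>b. br b a)"
  and br_hypocontinuous: "\<forall>M W. compactin (dual_c scE) M \<and> openin (dual_c scE) W \<and> (\<lambda>x. 0) \<in> W \<longrightarrow>
        (\<exists>V. openin (dual_c scE) V \<and> (\<lambda>x. 0) \<in> V \<and> (\<forall>v\<in>V. \<forall>m\<in>M. br v m \<in> W))"
  and eta_ad_in_range: "\<forall>x l. l \<in> dual scE \<longrightarrow> restrict (\<lambda>m. eta scE x (br l m)) (dual scE) \<in> range (eta scE)"
  by (insert poisson, unfold lc_poisson_def, elim conjE, assumption)+

lemmas br_in_dualI = br_in_dual[rule_format]
lemmas br_add_left = br_add[rule_format, THEN conjunct1]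
lemmas br_scale_left = br_scale[rule_format, THEN conjunct1]
lemmas br_continuous = br_separately_continuous[rule_format, THEN conjunct1]

lemma br_diff_left:
  assumes "a \<in> dual scE" "b \<in> dual scE" "c \<in> dual scE"
  shows "br (\<lambda>x. a x - b x) c = (\<lambda>x. br a c x - br b c x)"
  using br_add_left[OF assms(1) scale_in_dual[OF assms(2), of "- 1"] assms(3)]
    br_scale_left[OF assms(2,3), of "- 1"] by simp

section \<open>The topology of E as uniform convergence on compact sets of functionals\<close>

lemma eta_homeomorphic:
  "homeomorphic_map euclidean (subtopology (bidual_c scE) (range (eta scE))) (eta scE)"
  using embedding by (simp add: embedding_map_def)

lemma inj_eta: "inj (eta scE)"
  using homeomorphic_imp_injective_map[OF eta_homeomorphic] by simp

lemma eta_continuous: "continuous_map euclidean (bidual_c scE) (eta scE)"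
  using homeomorphic_imp_continuous_map[OF eta_homeomorphic] by (simp add: continuous_map_in_subtopology)

lemma eta_in_bidual: "eta scE x \<in> bidual scE"
proof -
  have "eta scE x \<in> topspace (bidual_c scE)"
    using eta_continuous by (simp add: continuous_map_def Pi_iff)
  then show ?thesis by (simp add: bidual_c_def)
qed

text \<open>Injectivity of \<open>eta\<close> takes the place of the Hahn-Banach theorem. All
  algebraic laws of \<open>beta\<close> are reduced to scalar identities in this way.\<close>

lemma dual_separates:
  assumes "\<And>m. m \<in> dual scE \<Longrightarrow> m x = m y"
  shows "x = y"
  using assms inj_eta by (intro injD[OF inj_eta]) (auto simp: eta_def fun_eq_iff restrict_def)

lemma E_nhd:
  assumes W: "open W" "x \<in> W"
  obtains M e where "compactin (dual_c scE) M" "e > 0"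
    "\<And>y. (\<And>m. m \<in> M \<Longrightarrow> norm (m y - m x) < e) \<Longrightarrow> y \<in> W"
proof -
  have "openin (subtopology (bidual_c scE) (range (eta scE))) (eta scE ` W)"
    using homeomorphic_map_openness_eq[OF eta_homeomorphic] W(1) by simp
  then obtain V where V: "openin (bidual_c scE) V" "eta scE ` W = V \<inter> range (eta scE)"
    unfolding openin_subtopology by (elim exE conjE)
  have "eta scE x \<in> V" using V(2) imageI[OF W(2), of "eta scE"] by simp
  from V(1)[unfolded bidual_c_def] this
  show thesis
  proof (rule uc_topology_nhd)
    fix M and e :: real
    assume M: "compactin (dual_c scE) M" and e: "e > 0"
      and sub: "\<And>g. g \<in> bidual scE \<Longrightarrow> (\<And>m. m \<in> M \<Longrightarrow> norm (g m - eta scE x m) < e) \<Longrightarrow> g \<in> V"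
    show thesis
    proof (rule that[OF M e])
      fix y assume y: "\<And>m. m \<in> M \<Longrightarrow> norm (m y - m x) < e"
      have "eta scE y \<in> V"
        using y compactin_dual_c_subset[OF M] by (intro sub eta_in_bidual) (simp add: eta_def)
      then have "eta scE y \<in> eta scE ` W" using V(2) by simp
      then show "y \<in> W" using inj_image_mem_iff[OF inj_eta] by simp
    qed
  qed
qed

lemma open_uniform_ball:
  assumes M: "compactin (dual_c scE) M"
  shows "open {y. \<forall>m\<in>M. norm (m y - m x) < e}"
proof -
  have ball: "openin (bidual_c scE) {g\<in>bidual scE. \<forall>m\<in>M. norm (g m - eta scE x m) < e}"
    unfolding bidual_c_def
    by (intro openin_uc_ball eta_in_bidual M) (simp add: bidual_def)
  have eta_M: "eta scE y m = m y" if "m \<in> M" for y m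
    using compactin_dual_c_subset[OF M that] by (simp add: eta_def)
  from openin_continuous_map_preimage[OF eta_continuous ball]
  have "open {y. eta scE y \<in> {g\<in>bidual scE. \<forall>m\<in>M. norm (g m - eta scE x m) < e}}"
    by simp
  moreover have "{y. eta scE y \<in> {g\<in>bidual scE. \<forall>m\<in>M. norm (g m - eta scE x m) < e}}
     = {y. \<forall>m\<in>M. norm (m y - m x) < e}"
    by (simp add: eta_in_bidual eta_M)
  ultimately show ?thesis by simp
qed

lemma tendsto_uniform:
  assumes "\<And>M e. compactin (dual_c scE) M \<Longrightarrow> e > 0 \<Longrightarrow> \<forall>\<^sub>F t in F. \<forall>m\<in>M. norm (m (g t) - m l) < e"
  shows "(g \<longlongrightarrow> l) F"
proof (rule topological_tendstoI)
  fix W assume "open W" "l \<in> W"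
  then show "\<forall>\<^sub>F t in F. g t \<in> W"
  proof (rule E_nhd)
    fix M and e :: real
    assume "compactin (dual_c scE) M" "e > 0"
      and *: "\<And>y. (\<And>m. m \<in> M \<Longrightarrow> norm (m y - m l) < e) \<Longrightarrow> y \<in> W"
    from assms[OF this(1,2)] show ?thesis
      by (rule eventually_mono) (simp add: *)
  qed
qed

lemma continuous_map_uniform:
  assumes "\<And>p M e. p \<in> topspace X \<Longrightarrow> compactin (dual_c scE) M \<Longrightarrow> e > 0 \<Longrightarrow>
     \<exists>N. openin X N \<and> p \<in> N \<and> (\<forall>q\<in>N. \<forall>m\<in>M. norm (m (g q) - m (g p)) < e)"
  shows "continuous_map X euclidean g"
  unfolding continuous_map_def
proof (intro conjI allI impI)
  fix W :: "'e set" assume W: "openin euclidean W"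
  show "openin X {p \<in> topspace X. g p \<in> W}"
  proof (subst openin_subopen, rule ballI)
    fix p assume "p \<in> {p \<in> topspace X. g p \<in> W}"
    then have p: "p \<in> topspace X" "g p \<in> W" by auto
    from W have "open W" by simp
    from this p(2) show "\<exists>T. openin X T \<and> p \<in> T \<and> T \<subseteq> {p \<in> topspace X. g p \<in> W}"
    proof (rule E_nhd)
      fix M and e :: real
      assume "compactin (dual_c scE) M" "e > 0"
        and *: "\<And>y. (\<And>m. m \<in> M \<Longrightarrow> norm (m y - m (g p)) < e) \<Longrightarrow> y \<in> W"
      from assms[OF p(1) this(1,2)] obtain N where N: "openin X N" "p \<in> N"
        "\<forall>q\<in>N. \<forall>m\<in>M. norm (m (g q) - m (g p)) < e" by (elim exE conjE)
      have "N \<subseteq> {p \<in> topspace X. g p \<in> W}"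
        using N openin_subset[OF N(1)] by (auto intro!: *)
      with N show ?thesis by (intro exI[of _ N] conjI)
    qed
  qed
qed auto

text \<open>Hypocontinuity for the neighbourhood of functionals that are below \<open>e\<close> on
  \<open>K\<close>. As \<open>K\<close> has to be compact for this to be a neighbourhood in E'_c,
  every later estimate must keep the point argument of \<open>beta\<close> in a compact set.\<close>

lemma br_uniform:
  assumes K: "compact K" and M: "compactin (dual_c scE) M" and e: "e > 0"
  obtains K' d where "compact K'" "d > 0"
    "\<And>\<mu> m x. \<mu> \<in> dual scE \<Longrightarrow> (\<And>z. z \<in> K' \<Longrightarrow> norm (\<mu> z) < d) \<Longrightarrow> m \<in> M \<Longrightarrow> x \<in> K \<Longrightarrow> norm (br \<mu> m x) < e"
proof -
  let ?W = "{g\<in>dual scE. \<forall>x\<in>K. norm (g x - 0) < e}"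
  have W: "openin (dual_c scE) ?W"
    using openin_dual_c_ball[OF zero_in_dual K] .
  have "(\<lambda>x. 0) \<in> ?W" using e zero_in_dual by simp
  from br_hypocontinuous[rule_format, OF conjI[OF M conjI[OF W this]]] obtain V where V: "openin (dual_c scE) V" "(\<lambda>x. 0) \<in> V" "\<forall>v\<in>V. \<forall>m\<in>M. br v m \<in> ?W"
    by (elim exE conjE)
  from V(1,2) show thesis
  proof (rule dual_c_zero_nhd)
    fix K' and d :: real
    assume "compact K'" "d > 0" and *: "\<And>g. g \<in> dual scE \<Longrightarrow> (\<And>x. x \<in> K' \<Longrightarrow> norm (g x) < d) \<Longrightarrow> g \<in> V"
    then show thesis
    proof (rule_tac that)
      fix \<mu> m x assume "\<mu> \<in> dual scE" "\<And>z. z \<in> K' \<Longrightarrow> norm (\<mu> z) < d" "m \<in> M" "x \<in> K"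
      then show "norm (br \<mu> m x) < e" using V(3) *[of \<mu>] by auto
    qed
  qed
qed

section \<open>The bilinear map behind Hamiltonian vector fields\<close>

definition beta :: "'e \<Rightarrow> ('e \<Rightarrow> 'k) \<Rightarrow> 'e" where
  "beta x l = inv (eta scE) (restrict (\<lambda>m. eta scE x (br l m)) (dual scE))"

lemma beta:
  assumes "l \<in> dual scE" "m \<in> dual scE"
  shows "m (beta x l) = br l m x"
proof -
  have "restrict (\<lambda>m. eta scE x (br l m)) (dual scE) \<in> range (eta scE)"
    using eta_ad_in_range[rule_format, OF assms(1)] .
  then have "eta scE (beta x l) = restrict (\<lambda>m. eta scE x (br l m)) (dual scE)"
    unfolding beta_def by (rule f_inv_into_f)
  then have "eta scE (beta x l) m = restrict (\<lambda>m. eta scE x (br l m)) (dual scE) m"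
    by simp
  then show ?thesis
    using assms br_in_dualI by (simp add: eta_def)
qed

lemma beta_add_left: "l \<in> dual scE \<Longrightarrow> beta (x + y) l = beta x l + beta y l"
  by (intro dual_separates) (simp add: beta dual_add br_in_dualI)

lemma beta_scale_left: "l \<in> dual scE \<Longrightarrow> beta (scE c x) l = scE c (beta x l)"
  by (intro dual_separates) (simp add: beta dual_scale br_in_dualI)

lemma beta_add_right: "l \<in> dual scE \<Longrightarrow> l' \<in> dual scE \<Longrightarrow> beta x (\<lambda>z. l z + l' z) = beta x l + beta x l'"
  by (intro dual_separates) (simp add: beta dual_add add_in_dual br_add_left)

lemma beta_scale_right: "l \<in> dual scE \<Longrightarrow> beta x (\<lambda>z. c * l z) = scE c (beta x l)"
  by (intro dual_separates) (simp add: beta dual_scale scale_in_dual br_scale_left)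

lemma beta_diff_right: "l \<in> dual scE \<Longrightarrow> l' \<in> dual scE \<Longrightarrow> beta x (\<lambda>z. l z - l' z) = beta x l - beta x l'"
  by (intro dual_separates) (simp add: beta dual_diff diff_in_dual br_diff_left)

lemma beta_split:
  assumes "l \<in> dual scE" "l' \<in> dual scE" "m \<in> dual scE"
  shows "m (beta x l) - m (beta x' l') = br (\<lambda>z. l z - l' z) m x + (br l' m x - br l' m x')"
  using assms by (simp add: beta br_diff_left)

lemma beta_tendsto_sequentially:
  assumes c: "c \<longlonglongrightarrow> c0" and l: "\<forall>\<^sub>F n in sequentially. l n \<in> dual scE" "l0 \<in> dual scE"
    and unif: "\<And>K e. compact K \<Longrightarrow> e > 0 \<Longrightarrow> \<forall>\<^sub>F n in sequentially. \<forall>z\<in>K. norm (l n z - l0 z) < e"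
  shows "(\<lambda>n. beta (c n) (l n)) \<longlonglongrightarrow> beta c0 l0"
proof (rule tendsto_uniform)
  fix M and e :: real assume M: "compactin (dual_c scE) M" and e: "e > 0"
  have "compactin euclidean (insert c0 (range c))"
    using c by (intro compactin_sequence_with_limit) auto
  then have K: "compact (insert c0 (range c))" by simp
  obtain K' d where K': "compact K'" "d > 0"
    "\<And>\<mu> m x. \<mu> \<in> dual scE \<Longrightarrow> (\<And>z. z \<in> K' \<Longrightarrow> norm (\<mu> z) < d) \<Longrightarrow> m \<in> M \<Longrightarrow>
       x \<in> insert c0 (range c) \<Longrightarrow> norm (br \<mu> m x) < e / 2"
    using br_uniform[OF K M, of "e / 2"] e by auto
  have "continuous_map (dual_c scE) (dual_c scE) (br l0)"
    by (rule br_continuous[OF l(2)])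
  then have "compactin (dual_c scE) (br l0 ` M)"
    by (rule image_compactin[OF M])
  then have "open {y. \<forall>m\<in>br l0 ` M. norm (m y - m c0) < e / 2}"
    by (rule open_uniform_ball)
  then have "\<forall>\<^sub>F n in sequentially. c n \<in> {y. \<forall>m\<in>br l0 ` M. norm (m y - m c0) < e / 2}"
    using e by (intro topological_tendstoD[OF c]) auto
  with unif[OF K'(1,2)] l(1)
  show "\<forall>\<^sub>F n in sequentially. \<forall>m\<in>M. norm (m (beta (c n) (l n)) - m (beta c0 l0)) < e"
  proof eventually_elim
    case (elim n)
    show ?case
    proof
      fix m assume m: "m \<in> M"
      then have md: "m \<in> dual scE" using compactin_dual_c_subset[OF M] by blast
      have "norm (br (\<lambda>z. l n z - l0 z) m (c n)) < e / 2"
        using elim m by (intro K'(3) diff_in_dual l(2)) auto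
      moreover have "norm (br l0 m (c n) - br l0 m c0) < e / 2"
        using elim m by auto
      ultimately show "norm (m (beta (c n) (l n)) - m (beta c0 l0)) < e"
        unfolding beta_split[OF elim(2) l(2) md]
        using norm_triangle_ineq[of "br (\<lambda>z. l n z - l0 z) m (c n)" "br l0 m (c n) - br l0 m c0"] by linarith
    qed
  qed
qed

text \<open>The limit is taken along sequences because a null sequence together with its limit is compact,
  whereas 'k is not known to be locally compact.\<close>

lemma beta_ddual_tendsto:
  assumes U: "open U" and f: "f \<in> smooth scE (*) U" and x: "x \<in> U"
  shows "((\<lambda>t. scE (inverse t) (beta (c + scE t v) (ddual f k (x + scE t (ys k)) ys) - beta c (ddual f k x ys)))
    \<longlongrightarrow> beta c (ddual f (Suc k) x ys) + beta v (ddual f k x ys)) (at 0)"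
  unfolding tendsto_at_iff_sequentially o_def
proof (intro allI impI)
  fix t :: "nat \<Rightarrow> 'k" assume "\<forall>i. t i \<in> UNIV - {0}" and t: "t \<longlonglongrightarrow> 0"
  then have t0: "t i \<noteq> 0" for i by simp
  then have t_at: "filterlim t (at 0) sequentially"
    using t by (intro filterlim_atI) auto
  let ?l = "\<lambda>n z. inverse (t n) * (ddual f k (x + scE (t n) (ys k)) ys z - ddual f k x ys z)"
  note D = ddual_in_dual[OF U f]
  have inU: "\<forall>\<^sub>F n in sequentially. x + scE (t n) (ys k) \<in> U"
    using topological_tendstoD[OF filterlim_compose[OF tendsto_line t_at] U x] .
  then have lD: "\<forall>\<^sub>F n in sequentially. ?l n \<in> dual scE"
    by eventually_elim (intro scale_in_dual diff_in_dual D x)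
  \<comment> \<open>By bilinearity the whole quotient is this sequence plus
    \<open>beta v (ddual f k x ys)\<close>, which is constant in \<open>n\<close>; only this summand
    needs a limit argument.\<close>
  have "(\<lambda>n. beta (c + scE (t n) v) (?l n)) \<longlonglongrightarrow> beta c (ddual f (Suc k) x ys)"
  proof (rule beta_tendsto_sequentially[OF _ lD D[OF x]])
    show "(\<lambda>n. c + scE (t n) v) \<longlonglongrightarrow> c"
      using filterlim_compose[OF tendsto_line t_at] .
    show "\<forall>\<^sub>F n in sequentially. \<forall>z\<in>K. norm (?l n z - ddual f (Suc k) x ys z) < e"
      if "compact K" "e > 0" for K and e :: real
      using ddual_diff_quotient_uniform[OF U f x that] t_at by (rule eventually_compose_filterlim)
  qed
  then have lim: "(\<lambda>n. beta (c + scE (t n) v) (?l n) + beta v (ddual f k x ys))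
      \<longlonglongrightarrow> beta c (ddual f (Suc k) x ys) + beta v (ddual f k x ys)"
    by (intro tendsto_E_add tendsto_const)
  have ev: "\<forall>\<^sub>F n in sequentially. beta (c + scE (t n) v) (?l n) + beta v (ddual f k x ys)
     = scE (inverse (t n)) (beta (c + scE (t n) v) (ddual f k (x + scE (t n) (ys k)) ys) - beta c (ddual f k x ys))"
    using inU
  proof eventually_elim
    case (elim n)
    have "beta (c + scE (t n) v) (?l n) = scE (inverse (t n))
       (beta (c + scE (t n) v) (ddual f k (x + scE (t n) (ys k)) ys) - beta (c + scE (t n) v) (ddual f k x ys))"
      using D[OF x] D[OF elim] by (simp add: beta_scale_right beta_diff_right diff_in_dual)
    also have "beta (c + scE (t n) v) (ddual f k x ys) = beta c (ddual f k x ys) + scE (t n) (beta v (ddual f k x ys))"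
      using D[OF x] by (simp add: beta_add_left beta_scale_left)
    finally show ?case
      using t0[of n] by (simp add: E.scale_right_diff_distrib E.scale_right_distrib)
  qed
  from Lim_transform_eventually[OF lim ev]
  show "(\<lambda>n. scE (inverse (t n)) (beta (c + scE (t n) v) (ddual f k (x + scE (t n) (ys k)) ys) - beta c (ddual f k x ys)))
    \<longlonglongrightarrow> beta c (ddual f (Suc k) x ys) + beta v (ddual f k x ys)" .
qed

lemma beta_ddual_continuous:
  assumes X: "k_space X" and U: "open U" and f: "f \<in> smooth scE (*) U"
    and a: "continuous_map X (subtopology euclidean U) a"
    and b: "\<And>i. i < k \<Longrightarrow> continuous_map X euclidean (\<lambda>p. b p i)"
    and c: "continuous_map X euclidean c"
  shows "continuous_map X euclidean (\<lambda>p. beta (c p) (ddual f k (a p) (b p)))"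
proof (rule continuous_map_from_k_space[OF X])
  fix L assume L: "compactin X L"
  have aU: "a p \<in> U" if "p \<in> topspace X" for p
    using a that by (auto simp: continuous_map_in_subtopology)
  note D = ddual_in_dual[OF U f aU]
  show "continuous_map (subtopology X L) euclidean (\<lambda>p. beta (c p) (ddual f k (a p) (b p)))"
  proof (rule continuous_map_uniform)
    fix p M and e :: real
    assume p: "p \<in> topspace (subtopology X L)" and M: "compactin (dual_c scE) M" and e: "e > 0"
    have pX: "p \<in> topspace X" "p \<in> L" using p by auto
    let ?l = "\<lambda>q. ddual f k (a q) (b q)"
    have K: "compact (c ` L)" using image_compactin[OF L c] by simp
    obtain K' d where K': "compact K'" "d > 0"
      "\<And>\<mu> m x. \<mu> \<in> dual scE \<Longrightarrow> (\<And>z. z \<in> K' \<Longrightarrow> norm (\<mu> z) < d) \<Longrightarrow> m \<in> M \<Longrightarrow>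
         x \<in> c ` L \<Longrightarrow> norm (br \<mu> m x) < e / 2"
      using br_uniform[OF K M, of "e / 2"] e by auto
    obtain N1 where N1: "openin X N1" "p \<in> N1" "\<forall>q\<in>N1. \<forall>z\<in>K'. norm (?l q z - ?l p z) < d"
      by (rule ddual_nhd[OF f a b pX(1) K'(1,2)])
    have "continuous_map (dual_c scE) (dual_c scE) (br (?l p))"
      by (rule br_continuous[OF D[OF pX(1)]])
    then have "compactin (dual_c scE) (br (?l p) ` M)"
      by (rule image_compactin[OF M])
    then have "open {y. \<forall>m\<in>br (?l p) ` M. norm (m y - m (c p)) < e / 2}"
      by (rule open_uniform_ball)
    then have N2: "openin X {q \<in> topspace X. c q \<in> {y. \<forall>m\<in>br (?l p) ` M. norm (m y - m (c p)) < e / 2}}"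
      (is "openin X ?N2")
      by (intro openin_continuous_map_preimage[OF c]) simp
    have "openin (subtopology X L) (L \<inter> (N1 \<inter> ?N2))"
      using N1(1) N2 by (intro openin_subtopology_Int2 openin_Int)
    moreover have "p \<in> L \<inter> (N1 \<inter> ?N2)"
      using pX N1 e by auto
    moreover have "norm (m (beta (c q) (?l q)) - m (beta (c p) (?l p))) < e"
      if q: "q \<in> L \<inter> (N1 \<inter> ?N2)" and m: "m \<in> M" for q m
    proof -
      have md: "m \<in> dual scE" using compactin_dual_c_subset[OF M] m by blast
      have qX: "q \<in> topspace X" using q by auto
      have "norm (br (\<lambda>z. ?l q z - ?l p z) m (c q)) < e / 2"
        using q m N1(3) by (intro K'(3) diff_in_dual D qX pX(1)) auto
      moreover have "norm (br (?l p) m (c q) - br (?l p) m (c p)) < e / 2"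
        using q m by auto
      ultimately show ?thesis
        unfolding beta_split[OF D[OF qX] D[OF pX(1)] md]
        using norm_triangle_ineq[of "br (\<lambda>z. ?l q z - ?l p z) m (c q)" "br (?l p) m (c q) - br (?l p) m (c p)"]
        by linarith
    qed
    ultimately show "\<exists>N. openin (subtopology X L) N \<and> p \<in> N \<and>
       (\<forall>q\<in>N. \<forall>m\<in>M. norm (m (beta (c q) (?l q)) - m (beta (c p) (?l p))) < e)"
      by (intro exI[of _ "L \<inter> (N1 \<inter> ?N2)"] conjI ballI)
  qed
qed

end

section \<open>The topology on spaces of smooth functions\<close>

lemma topspace_smooth_top [simp]: "topspace (smooth_top scE scF U) = smooth scE scF U"
  unfolding smooth_top_def by auto

lemma openin_smooth_top:
  fixes scE :: "'k::real_normed_field \<Rightarrow> 'e::{ab_group_add,t2_space} \<Rightarrow> 'e"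
    and scF :: "'k \<Rightarrow> 'f::{ab_group_add,t2_space} \<Rightarrow> 'f"
  assumes L: "compactin (UEk U k) L" and W: "open W"
  shows "openin (smooth_top scE scF U) {f\<in>smooth scE scF U. \<forall>p\<in>L. iter_d scE scF f k p \<in> W}"
proof -
  let ?T = "topspace (UEk U k)"
  define S :: "('e \<times> (nat \<Rightarrow> 'e) \<Rightarrow> 'f) set"
    where "S = {g. continuous_map (UEk U k) euclidean g \<and> g \<in> extensional ?T}"
  let ?V = "{g\<in>S. g ` L \<subseteq> W}"
  have LT: "L \<subseteq> ?T" using compactin_subset_topspace[OF L] .
  have "openin (compact_open (UEk U k) euclidean S) (S \<inter> ?V)"
    unfolding compact_open_def
    by (intro openin_subtopology_Int2 topology_generated_by_Basis) (use L W in auto)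
  moreover have "S \<inter> ?V = ?V" by auto
  ultimately have V: "openin (compact_open (UEk U k) euclidean S) ?V" by simp
  have "openin (smooth_top scE scF U)
    (smooth scE scF U \<inter> {f\<in>smooth scE scF U. restrict (iter_d scE scF f k) ?T \<in> ?V})"
    unfolding smooth_top_def
  proof (intro openin_subtopology_Int2 topology_generated_by_Basis insertI2 CollectI)
    show "\<exists>k' V. {f\<in>smooth scE scF U. restrict (iter_d scE scF f k) ?T \<in> ?V} =
        {f\<in>smooth scE scF U. restrict (iter_d scE scF f k') (topspace (UEk U k')) \<in> V} \<and>
        openin (compact_open (UEk U k') euclidean
          {g. continuous_map (UEk U k') euclidean g \<and> g \<in> extensional (topspace (UEk U k'))}) V"
      using V unfolding S_def by (intro exI[of _ k] exI[of _ ?V] conjI) (simp_all add: S_def)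
  qed
  moreover have "restrict (iter_d scE scF f k) ?T \<in> S" if "f \<in> smooth scE scF U" for f
  proof -
    have "continuous_map (UEk U k) euclidean (iter_d scE scF f k)"
      using that by (simp add: smooth_def)
    then have "continuous_map (UEk U k) euclidean (restrict (iter_d scE scF f k) ?T)"
      by (rule continuous_map_eq) simp
    then show ?thesis by (simp add: S_def)
  qed
  then have "smooth scE scF U \<inter> {f\<in>smooth scE scF U. restrict (iter_d scE scF f k) ?T \<in> ?V}
     = {f\<in>smooth scE scF U. \<forall>p\<in>L. iter_d scE scF f k p \<in> W}"
    using LT by (auto simp: image_subset_iff subset_iff)
  ultimately show ?thesis by simp
qed

lemma continuous_map_into_compact_open:
  assumes S: "\<And>x. x \<in> topspace X \<Longrightarrow> g x \<in> S"
    and op: "\<And>L W. compactin Y L \<Longrightarrow> openin Z W \<Longrightarrow> openin X {x\<in>topspace X. g x ` L \<subseteq> W}"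
  shows "continuous_map X (compact_open Y Z S) g"
  unfolding compact_open_def continuous_map_in_subtopology
proof (intro conjI continuous_on_generated_topo)
  fix A assume "A \<in> insert S {{f\<in>S. f ` K \<subseteq> W} |K W. compactin Y K \<and> openin Z W}"
  then consider "A = S" | K W where "A = {f\<in>S. f ` K \<subseteq> W}" "compactin Y K" "openin Z W"
    by auto
  then show "openin X (g -` A \<inter> topspace X)"
  proof cases
    case 1
    then have "g -` A \<inter> topspace X = topspace X" using S by auto
    then show ?thesis by simp
  next
    case 2
    then have "g -` A \<inter> topspace X = {x\<in>topspace X. g x ` K \<subseteq> W}" using S by auto
    then show ?thesis using op[OF 2(2,3)] by simp
  qed
qed (use S in auto)

text \<open>The C^\<infinity>-topology pulls back compact-open topologies, and these are generated
  by the conditions that a compact \<open>L\<close> be mapped into an open \<open>W\<close>;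
  continuity need only be tested on those.\<close>

lemma continuous_map_into_smooth_top:
  fixes scE :: "'k::real_normed_field \<Rightarrow> 'e::{ab_group_add,t2_space} \<Rightarrow> 'e"
    and scF :: "'k \<Rightarrow> 'f::{ab_group_add,t2_space} \<Rightarrow> 'f"
  assumes S: "\<And>f. f \<in> topspace X \<Longrightarrow> \<Psi> f \<in> smooth scE scF U"
    and op: "\<And>k L W. compactin (UEk U k) L \<Longrightarrow> open W \<Longrightarrow>
      openin X {f\<in>topspace X. \<forall>p\<in>L. iter_d scE scF (\<Psi> f) k p \<in> W}"
  shows "continuous_map X (smooth_top scE scF U) \<Psi>"
  unfolding smooth_top_def continuous_map_in_subtopology
proof (intro conjI continuous_on_generated_topo)
  let ?S = "\<lambda>k. {g. continuous_map (UEk U k) euclidean g \<and> g \<in> extensional (topspace (UEk U k))}"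
  let ?r = "\<lambda>k f. restrict (iter_d scE scF f k) (topspace (UEk U k))"
  fix A assume "A \<in> insert (smooth scE scF U) {{f\<in>smooth scE scF U. ?r k f \<in> V} | k V.
      openin (compact_open (UEk U k) euclidean (?S k)) V}"
  then consider "A = smooth scE scF U" | k V where "A = {f\<in>smooth scE scF U. ?r k f \<in> V}"
      "openin (compact_open (UEk U k) euclidean (?S k)) V"
    by auto
  then show "openin X (\<Psi> -` A \<inter> topspace X)"
  proof cases
    case 1
    then have "\<Psi> -` A \<inter> topspace X = topspace X" using S by auto
    then show ?thesis by simp
  next
    case 2
    have "continuous_map X (compact_open (UEk U k) euclidean (?S k)) (\<lambda>f. ?r k (\<Psi> f))"
    proof (rule continuous_map_into_compact_open)
      fix f assume "f \<in> topspace X"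
      then have "continuous_map (UEk U k) euclidean (iter_d scE scF (\<Psi> f) k)"
        using S[of f] by (simp add: smooth_def)
      then have "continuous_map (UEk U k) euclidean (?r k (\<Psi> f))"
        by (rule continuous_map_eq) simp
      then show "?r k (\<Psi> f) \<in> ?S k" by simp
    next
      fix L and W :: "'f set" assume L: "compactin (UEk U k) L" and W: "openin euclidean W"
      have "{f\<in>topspace X. \<forall>p\<in>L. iter_d scE scF (\<Psi> f) k p \<in> W} = {f\<in>topspace X. ?r k (\<Psi> f) ` L \<subseteq> W}"
        using compactin_subset_topspace[OF L] by (auto simp: image_subset_iff subset_iff)
      then show "openin X {f\<in>topspace X. ?r k (\<Psi> f) ` L \<subseteq> W}"
        using op[OF L, of W] W by simp
    qed
    from openin_continuous_map_preimage[OF this 2(2)]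
    have "openin X {f\<in>topspace X. ?r k (\<Psi> f) \<in> V}" .
    moreover have "{f\<in>topspace X. ?r k (\<Psi> f) \<in> V} = \<Psi> -` A \<inter> topspace X"
      using S 2(1) by auto
    ultimately show ?thesis by simp
  qed
qed (use S in auto)

text \<open>For values in a normed space the compact-open topology gives uniform closeness on
  compact sets: finitely many small balls cover the image of \<open>L\<close> under the derivative
  of \<open>f0\<close>.\<close>

lemma smooth_top_uniform_nhd:
  fixes f0 :: "'e::{ab_group_add,t2_space} \<Rightarrow> 'f::{ab_group_add,real_normed_vector}"
  assumes f0: "f0 \<in> smooth scE scF U" and L: "compactin (UEk U k) L" and e: "e > 0"
  obtains B where "openin (smooth_top scE scF U) B" "f0 \<in> B"
    "\<forall>f\<in>B. \<forall>p\<in>L. norm (iter_d scE scF f k p - iter_d scE scF f0 k p) < e"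
proof -
  let ?g = "iter_d scE scF f0 k"
  have g: "continuous_map (UEk U k) euclidean ?g"
    using f0 by (simp add: smooth_def)
  have cpt: "compact (?g ` L)" using image_compactin[OF L g] by simp
  have "?g ` L \<subseteq> (\<Union>c\<in>?g ` L. ball c (e / 4))" using e by auto
  then obtain F where F: "F \<subseteq> ?g ` L" "finite F" "?g ` L \<subseteq> (\<Union>c\<in>F. ball c (e / 4))"
    by (rule compactE_image[OF cpt open_ball])
  \<comment> \<open>Closed balls keep these pieces of \<open>L\<close> compact. Their radius
    \<open>e / 4\<close> lies below the radius \<open>e / 2\<close> demanded of \<open>f\<close>, so
    \<open>f0\<close> qualifies, and \<open>e / 2 + e / 4 < e\<close> gives the final bound.\<close>
  define Lc where "Lc c = L \<inter> {p\<in>topspace (UEk U k). ?g p \<in> cball c (e / 4)}" for c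
  have Lc: "compactin (UEk U k) (Lc c)" for c
    unfolding Lc_def
    by (intro compact_Int_closedin L closedin_continuous_map_preimage[OF g]) simp
  \<comment> \<open>The factor \<open>topspace\<close> keeps \<open>B\<close> a set of smooth
    functions when \<open>F\<close> is empty.\<close>
  define B where "B = (\<Inter>c\<in>F. {f\<in>smooth scE scF U. \<forall>p\<in>Lc c. iter_d scE scF f k p \<in> ball c (e / 2)})
      \<inter> topspace (smooth_top scE scF U)"
  have "openin (smooth_top scE scF U) B"
    unfolding B_def using F(2) Lc by (intro openin_INT openin_smooth_top) auto
  moreover have "f0 \<in> B"
    using f0 e by (auto simp: B_def Lc_def)
  moreover have "norm (iter_d scE scF f k p - ?g p) < e" if f: "f \<in> B" and p: "p \<in> L" for f p
  proof -
    have "?g p \<in> (\<Union>c\<in>F. ball c (e / 4))" using F(3) imageI[OF p] by (rule subsetD)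
    then obtain c where c: "c \<in> F" "?g p \<in> ball c (e / 4)" by (rule UN_E)
    then have "p \<in> Lc c"
      using p compactin_subset_topspace[OF L] by (auto simp: Lc_def)
    then have "iter_d scE scF f k p \<in> ball c (e / 2)"
      using f c(1) by (auto simp: B_def)
    then have "dist (iter_d scE scF f k p) (?g p) < e / 2 + e / 4"
      using c(2) by (intro dist_triangle_less_add[of _ c]) (auto simp: dist_commute)
    then show ?thesis using e by (simp add: dist_norm)
  qed
  ultimately show thesis by (intro that[of B]) auto
qed

section \<open>The derivatives of a Hamiltonian vector field\<close>

text \<open>The directions with entry \<open>j\<close> deleted: in the product rule direction
  \<open>j\<close> falls on the base point and the remaining ones fall on f'.\<close>

definition skip :: "nat \<Rightarrow> (nat \<Rightarrow> 'a) \<Rightarrow> nat \<Rightarrow> 'a" where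
  "skip j ys = (\<lambda>i. ys (if i < j then i else Suc i))"

lemma continuous_map_UEk_fst: "continuous_map (UEk U k) (subtopology euclidean U) fst"
  unfolding UEk_def by (rule continuous_map_fst)

lemma continuous_map_UEk_fst': "continuous_map (UEk U k) euclidean fst"
  using continuous_map_UEk_fst unfolding continuous_map_in_subtopology by (rule conjunct1)

lemma continuous_map_UEk_snd:
  assumes "i < k"
  shows "continuous_map (UEk U k) euclidean (\<lambda>p. snd p i)"
  unfolding UEk_def
  using assms continuous_map_compose[OF continuous_map_snd continuous_map_product_projection[of i "{..<k}"]]
  by (simp add: o_def)

lemma continuous_map_UEk_skip:
  assumes "j < k" "i < k - 1"
  shows "continuous_map (UEk U k) euclidean (\<lambda>p. skip j (snd p) i)"
  unfolding skip_def using assms by (intro continuous_map_UEk_snd) auto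

context poisson_space
begin

text \<open>Products of k-spaces need not be k-spaces, so the space is realised inside the single
  power of E with \<open>Suc k\<close> factors, as the open set where coordinate 0 lies in
  \<open>U\<close>. Open subspaces of Hausdorff k-spaces are k-spaces.\<close>

lemma k_space_UEk:
  assumes U: "open (U :: 'e set)"
  shows "k_space (UEk U k)"
proof -
  let ?P = "product_topology (\<lambda>_. euclidean :: 'e topology) {..<Suc k}"
  let ?S = "{g \<in> topspace ?P. g 0 \<in> U}"
  have "openin ?P ?S"
    using U by (intro openin_continuous_map_preimage[where Y = euclidean] continuous_map_product_projection) auto
  moreover have "Hausdorff_space ?P" "k_space ?P"
    using k_infinity by (auto simp: k_infinity_space_def Hausdorff_space_product_topology)
  ultimately have kS: "k_space (subtopology ?P ?S)"
    by (intro k_space_open_subtopology) auto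
  have hom: "homeomorphic_maps (subtopology ?P ?S) (UEk U k)
      (\<lambda>g. (g 0, \<lambda>i\<in>{..<k}. g (Suc i))) (\<lambda>(x, ys). \<lambda>i\<in>{..<Suc k}. case_nat x ys i)"
    unfolding homeomorphic_maps_def
  proof (intro conjI ballI)
    have proj: "continuous_map (subtopology ?P ?S) euclidean (\<lambda>g. g i)" if "i < Suc k" for i
      using that by (intro continuous_map_from_subtopology continuous_map_product_projection) auto
    show "continuous_map (subtopology ?P ?S) (UEk U k) (\<lambda>g. (g 0, \<lambda>i\<in>{..<k}. g (Suc i)))"
      unfolding UEk_def continuous_map_paired continuous_map_in_subtopology continuous_map_componentwise
      using proj by auto
    have "continuous_map (UEk U k) euclidean (\<lambda>p. case_nat (fst p) (snd p) i)" if "i < Suc k" for i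
      using that by (cases i) (auto intro: continuous_map_UEk_fst' continuous_map_UEk_snd)
    then show "continuous_map (UEk U k) (subtopology ?P ?S) (\<lambda>(x, ys). \<lambda>i\<in>{..<Suc k}. case_nat x ys i)"
      unfolding continuous_map_in_subtopology continuous_map_componentwise
      by (auto simp: case_prod_unfold UEk_def)
  next
    fix g assume "g \<in> topspace (subtopology ?P ?S)"
    then have g: "g \<in> extensional {..<Suc k}" by (auto simp: PiE_iff)
    show "(case (g 0, \<lambda>i\<in>{..<k}. g (Suc i)) of (x, ys) \<Rightarrow> \<lambda>i\<in>{..<Suc k}. case_nat x ys i) = g"
    proof (rule ext)
      fix i show "(case (g 0, \<lambda>i\<in>{..<k}. g (Suc i)) of (x, ys) \<Rightarrow> \<lambda>i\<in>{..<Suc k}. case_nat x ys i) i = g i"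
        using g by (cases i) (simp_all add: extensional_def)
    qed
  next
    fix p assume "p \<in> topspace (UEk U k)"
    moreover obtain x ys where p: "p = (x, ys)" by (cases p)
    ultimately have "ys \<in> extensional {..<k}"
      by (simp add: UEk_def PiE_def)
    then have "(\<lambda>i\<in>{..<k}. ys i) = ys"
      by (rule extensional_restrict)
    moreover have "(\<lambda>i\<in>{..<k}. (\<lambda>i\<in>{..<Suc k}. case_nat x ys i) (Suc i)) = (\<lambda>i\<in>{..<k}. ys i)"
      by (rule restrict_ext) simp
    ultimately show "((case p of (x, ys) \<Rightarrow> \<lambda>i\<in>{..<Suc k}. case_nat x ys i) 0,
         \<lambda>i\<in>{..<k}. (case p of (x, ys) \<Rightarrow> \<lambda>i\<in>{..<Suc k}. case_nat x ys i) (Suc i)) = p"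
      by (simp add: p)
  qed
  show ?thesis
    by (rule iffD1[OF homeomorphic_k_space[OF homeomorphic_maps_imp_homeomorphic_space[OF hom]] kS])
qed

text \<open>The derivative of order \<open>k\<close> of the Hamiltonian vector field, from the product rule
  applied to \<open>x \<mapsto> beta x (f' x)\<close>, where \<open>beta\<close> is linear in \<open>x\<close>.\<close>

definition hamd :: "('e \<Rightarrow> 'k) \<Rightarrow> nat \<Rightarrow> 'e \<Rightarrow> (nat \<Rightarrow> 'e) \<Rightarrow> 'e" where
  "hamd f k x ys = beta x (ddual f k x ys) + (\<Sum>j<k. beta (ys j) (ddual f (k - 1) x (skip j ys)))"

text \<open>The leading summand yields two terms, as both the point and the functional move; each
  summand \<open>j < k\<close> yields one, as its point \<open>ys j\<close> stays fixed. The extra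
  term \<open>beta (ys k) (ddual f k x ys)\<close> becomes the summand \<open>j = k\<close> at order
  \<open>Suc k\<close>.\<close>

lemma hamd_tendsto:
  assumes U: "open U" and f: "f \<in> smooth scE (*) U" and x: "x \<in> U"
  shows "((\<lambda>t. scE (inverse t) (hamd f k (x + scE t (ys k)) ys - hamd f k x ys))
    \<longlongrightarrow> hamd f (Suc k) x ys) (at 0)"
proof -
  note D = ddual_in_dual[OF U f x]
  let ?q = "\<lambda>j t. scE (inverse t) (beta (ys j) (ddual f (k - 1) (x + scE t (ys k)) (skip j ys))
      - beta (ys j) (ddual f (k - 1) x (skip j ys)))"
  have q: "(?q j \<longlongrightarrow> beta (ys j) (ddual f k x (skip j ys))) (at 0)" if j: "j < k" for j
  proof -
    \<comment> \<open>From \<open>j < k\<close> the order \<open>k - 1\<close> is a genuine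
      predecessor, and deleting entry \<open>j\<close> shifts \<open>ys k\<close> into slot
      \<open>k - 1\<close>, the next direction. The point does not move, so
      \<open>beta_ddual_tendsto\<close> is used with \<open>v = 0\<close>.\<close>
    have "skip j ys (k - 1) = ys k" "Suc (k - 1) = k"
      using j by (auto simp: skip_def)
    moreover have "beta 0 l = 0" if "l \<in> dual scE" for l
      using beta_scale_left[OF that, of 0 0] by simp
    ultimately show ?thesis
      using beta_ddual_tendsto[OF U f x, of "ys j" 0 "k - 1" "skip j ys"] D by simp
  qed
  let ?p = "\<lambda>t. scE (inverse t) (beta (x + scE t (ys k)) (ddual f k (x + scE t (ys k)) ys) - beta x (ddual f k x ys))"
  have p: "(?p \<longlongrightarrow> beta x (ddual f (Suc k) x ys) + beta (ys k) (ddual f k x ys)) (at 0)"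
    by (rule beta_ddual_tendsto[OF U f x])
  have "((\<lambda>t. ?p t + (\<Sum>j<k. ?q j t)) \<longlongrightarrow>
      beta x (ddual f (Suc k) x ys) + beta (ys k) (ddual f k x ys) + (\<Sum>j<k. beta (ys j) (ddual f k x (skip j ys)))) (at 0)"
    using q by (intro tendsto_E_add p tendsto_E_sum) auto
  moreover have "?p t + (\<Sum>j<k. ?q j t) = scE (inverse t) (hamd f k (x + scE t (ys k)) ys - hamd f k x ys)" for t
    unfolding hamd_def E.scale_sum_right[symmetric] sum_subtractf E.scale_right_distrib[symmetric]
    by (simp add: algebra_simps)
  moreover have "ddual f k x (skip k ys) = ddual f k x ys"
    by (rule ddual_cong) (simp add: skip_def)
  then have "beta x (ddual f (Suc k) x ys) + beta (ys k) (ddual f k x ys) + (\<Sum>j<k. beta (ys j) (ddual f k x (skip j ys)))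
      = hamd f (Suc k) x ys"
    unfolding hamd_def by (simp add: add_ac)
  ultimately show ?thesis by simp
qed

lemma hamvf_eq_beta:
  assumes "x \<in> U"
  shows "hamvf scE br U f x = beta x (ddual f 0 x ys)"
proof -
  have "(\<lambda>y. iter_d scE (*) f 1 (x, \<lambda>_. y)) = ddual f 0 x ys"
    unfolding ddual_def One_nat_def by (intro ext iter_d_cong) simp
  then show ?thesis using assms by (simp add: hamvf_def beta_def)
qed

text \<open>The formula at order \<open>k\<close> is an assumption, so that the lemma provides the
  induction step of \<open>iter_d_hamvf\<close> and afterwards, with that result, the limits
  required by \<open>smooth\<close>. The formula holds only on \<open>U\<close>, which the quotient
  sees for small \<open>t\<close>.\<close>

lemma iter_d_hamvf_quotient:
  assumes U: "open U" and f: "f \<in> smooth scE (*) U" and x: "x \<in> U"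
    and eq: "\<And>x. x \<in> U \<Longrightarrow> iter_d scE scE (hamvf scE br U f) k (x, ys) = hamd f k x ys"
  shows "((\<lambda>t. scE (inverse t) (iter_d scE scE (hamvf scE br U f) k (x + scE t (ys k), ys)
      - iter_d scE scE (hamvf scE br U f) k (x, ys))) \<longlongrightarrow> hamd f (Suc k) x ys) (at 0)"
proof (rule Lim_transform_eventually[OF hamd_tendsto[OF U f x]])
  have "\<forall>\<^sub>F t in at 0. x + scE t (ys k) \<in> U"
    using topological_tendstoD[OF tendsto_line U x] .
  then show "\<forall>\<^sub>F t in at 0. scE (inverse t) (hamd f k (x + scE t (ys k)) ys - hamd f k x ys)
     = scE (inverse t) (iter_d scE scE (hamvf scE br U f) k (x + scE t (ys k), ys)
      - iter_d scE scE (hamvf scE br U f) k (x, ys))"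
    by (rule eventually_mono) (simp add: eq x)
qed

lemma iter_d_hamvf:
  assumes U: "open U" and f: "f \<in> smooth scE (*) U" and x: "x \<in> U"
  shows "iter_d scE scE (hamvf scE br U f) k (x, ys) = hamd f k x ys"
  using x
proof (induction k arbitrary: x)
  case 0
  then show ?case by (simp add: hamd_def hamvf_eq_beta[where ys = ys])
next
  case (Suc k)
  from tendsto_Lim[OF _ iter_d_hamvf_quotient[OF U f Suc.prems Suc.IH]]
  show ?case by (simp add: iter_d.simps(2))
qed

lemma hamvf_smooth:
  assumes U: "open U" and f: "f \<in> smooth scE (*) U"
  shows "hamvf scE br U f \<in> smooth scE scE U"
  unfolding smooth_def
proof (intro CollectI conjI allI impI)
  show "hamvf scE br U f x = 0" if "x \<notin> U" for x
    using that by (simp add: hamvf_def)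
  show "\<exists>L. ((\<lambda>t. scE (inverse t) (iter_d scE scE (hamvf scE br U f) k (x + scE t (ys k), ys)
      - iter_d scE scE (hamvf scE br U f) k (x, ys))) \<longlongrightarrow> L) (at 0)" if "x \<in> U" for k x ys
    using iter_d_hamvf_quotient[OF U f that iter_d_hamvf[OF U f]] by (rule exI)
  show "continuous_map (UEk U k) euclidean (iter_d scE scE (hamvf scE br U f) k)" for k
  proof (rule continuous_map_eq)
    show "continuous_map (UEk U k) euclidean (\<lambda>p. hamd f k (fst p) (snd p))"
      unfolding hamd_def
      by (intro continuous_map_add continuous_map_E_sum beta_ddual_continuous[OF k_space_UEk[OF U] U f])
        (auto intro: continuous_map_UEk_fst continuous_map_UEk_fst' continuous_map_UEk_snd continuous_map_UEk_skip)
    show "hamd f k (fst p) (snd p) = iter_d scE scE (hamvf scE br U f) k p" if "p \<in> topspace (UEk U k)" for p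
      using that iter_d_hamvf[OF U f, of "fst p" k "snd p"] by (simp add: UEk_def mem_Times_iff)
  qed
qed

section \<open>Continuous dependence of the derivatives on the function\<close>

lemma br_ddual_uniform_nhd:
  assumes U: "open U" and f0: "f0 \<in> smooth scE (*) U" and L: "compactin X L"
    and a: "continuous_map X (subtopology euclidean U) a"
    and b: "\<And>i. i < k \<Longrightarrow> continuous_map X euclidean (\<lambda>p. b p i)"
    and c: "continuous_map X euclidean c"
    and M: "compactin (dual_c scE) M" and e: "e > 0"
  shows "\<exists>B. openin (smooth_top scE (*) U) B \<and> f0 \<in> B \<and> (\<forall>f\<in>B. \<forall>p\<in>L. \<forall>m\<in>M.
     norm (br (ddual f k (a p) (b p)) m (c p) - br (ddual f0 k (a p) (b p)) m (c p)) < e)"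
proof -
  have K: "compact (c ` L)" using image_compactin[OF L c] by simp
  obtain K' d where K': "compact K'" "d > 0"
    "\<And>\<mu> m x. \<mu> \<in> dual scE \<Longrightarrow> (\<And>z. z \<in> K' \<Longrightarrow> norm (\<mu> z) < d) \<Longrightarrow> m \<in> M \<Longrightarrow>
       x \<in> c ` L \<Longrightarrow> norm (br \<mu> m x) < e"
    using br_uniform[OF K M e] by auto
  \<comment> \<open>The pair of a parameter and an argument \<open>z\<close> is sent to a point of
    \<open>UEk U (Suc k)\<close> with \<open>z\<close> as direction 0. Closeness of the derivatives
    of order \<open>k + 1\<close> on the compact image of \<open>L \<times> K'\<close> is then
    closeness of the functionals on \<open>K'\<close>, uniformly over \<open>L\<close>.\<close>
  define q where "q w = (a (fst w), restrict (case_nat (snd w) (b (fst w))) {..<Suc k})" for w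
  have fst: "continuous_map (prod_topology X euclidean) Y (\<lambda>w. g (fst w))"
    if "continuous_map X Y g" for g :: "_ \<Rightarrow> 'z" and Y
    using continuous_map_compose[OF continuous_map_fst that] by (simp add: o_def)
  have "continuous_map (prod_topology X euclidean) euclidean (\<lambda>w. case_nat (snd w) (b (fst w)) i)"
    if "i < Suc k" for i
    using that fst[OF b] by (cases i) (auto intro: continuous_map_snd)
  then have "continuous_map (prod_topology X (euclidean :: 'e topology)) (UEk U (Suc k)) q"
    unfolding q_def UEk_def continuous_map_paired continuous_map_componentwise
    using fst[OF a] by auto
  moreover have "compactin (prod_topology X euclidean) (L \<times> K')"
    using L K'(1) by (simp add: compactin_Times)
  ultimately have q: "compactin (UEk U (Suc k)) (q ` (L \<times> K'))"
    by (rule image_compactin[rotated])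
  obtain B where B: "openin (smooth_top scE (*) U) B" "f0 \<in> B"
    "\<forall>f\<in>B. \<forall>p\<in>q ` (L \<times> K'). norm (iter_d scE (*) f (Suc k) p - iter_d scE (*) f0 (Suc k) p) < d"
    by (rule smooth_top_uniform_nhd[OF f0 q K'(2)])
  have iter_q: "iter_d scE (*) f (Suc k) (q (p, z)) = ddual f k (a p) (b p) z" for f p z
    unfolding q_def ddual_def fst_conv snd_conv by (rule iter_d_cong) simp
  have "norm (br (ddual f k (a p) (b p)) m (c p) - br (ddual f0 k (a p) (b p)) m (c p)) < e"
    if f: "f \<in> B" and p: "p \<in> L" and m: "m \<in> M" for f p m
  proof -
    have fs: "f \<in> smooth scE (*) U"
      using openin_subset[OF B(1)] f by auto
    have aU: "a p \<in> U"
      using a p compactin_subset_topspace[OF L] by (auto simp: continuous_map_in_subtopology)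
    note D = ddual_in_dual[OF U fs aU] ddual_in_dual[OF U f0 aU]
    have "norm (ddual f k (a p) (b p) z - ddual f0 k (a p) (b p) z) < d" if "z \<in> K'" for z
      using bspec[OF bspec[OF B(3) f] imageI[of "(p, z)" "L \<times> K'" q]] p that by (simp add: iter_q)
    then have "norm (br (\<lambda>z. ddual f k (a p) (b p) z - ddual f0 k (a p) (b p) z) m (c p)) < e"
      using p m by (intro K'(3) diff_in_dual D) auto
    then show ?thesis
      using br_diff_left[OF D compactin_dual_c_subset[OF M m]] by simp
  qed
  then show ?thesis using B(1,2) by (intro exI[of _ B]) auto
qed

lemma hamd_uniform_nhd:
  assumes U: "open U" and f0: "f0 \<in> smooth scE (*) U" and L: "compactin (UEk U k) L"
    and M: "compactin (dual_c scE) M" and e: "e > 0"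
  shows "\<exists>B. openin (smooth_top scE (*) U) B \<and> f0 \<in> B \<and> (\<forall>f\<in>B. \<forall>p\<in>L. \<forall>m\<in>M.
     norm (m (hamd f k (fst p) (snd p)) - m (hamd f0 k (fst p) (snd p))) < e)"
proof -
  \<comment> \<open>\<open>hamd\<close> has \<open>k + 1\<close> summands, each of which is allowed
    an error \<open>d\<close>.\<close>
  define d where "d = e / (real k + 1)"
  have d: "d > 0" using e by (simp add: d_def)
  let ?S = "\<lambda>f p. ddual f k (fst p) (snd p)"
  let ?T = "\<lambda>f j p. ddual f (k - 1) (fst p) (skip j (snd p))"
  have "\<exists>B. openin (smooth_top scE (*) U) B \<and> f0 \<in> B \<and> (\<forall>f\<in>B. \<forall>p\<in>L. \<forall>m\<in>M.
     norm (br (?S f p) m (fst p) - br (?S f0 p) m (fst p)) < d)"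
    by (rule br_ddual_uniform_nhd[OF U f0 L continuous_map_UEk_fst continuous_map_UEk_snd
          continuous_map_UEk_fst' M d])
  then obtain A where A: "openin (smooth_top scE (*) U) A" "f0 \<in> A"
    "\<forall>f\<in>A. \<forall>p\<in>L. \<forall>m\<in>M. norm (br (?S f p) m (fst p) - br (?S f0 p) m (fst p)) < d"
    by (elim exE conjE)
  have "\<forall>j\<in>{..<k}. \<exists>B. openin (smooth_top scE (*) U) B \<and> f0 \<in> B \<and> (\<forall>f\<in>B. \<forall>p\<in>L. \<forall>m\<in>M.
     norm (br (?T f j p) m (snd p j) - br (?T f0 j p) m (snd p j)) < d)"
    by (intro ballI br_ddual_uniform_nhd[OF U f0 L continuous_map_UEk_fst continuous_map_UEk_skip
          continuous_map_UEk_snd M d]) auto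
  from bchoice[OF this] obtain B where "\<forall>j\<in>{..<k}. openin (smooth_top scE (*) U) (B j) \<and> f0 \<in> B j \<and>
     (\<forall>f\<in>B j. \<forall>p\<in>L. \<forall>m\<in>M. norm (br (?T f j p) m (snd p j) - br (?T f0 j p) m (snd p j)) < d)"
    by (rule exE)
  then have B: "\<And>j. j < k \<Longrightarrow> openin (smooth_top scE (*) U) (B j)"
    "\<And>j. j < k \<Longrightarrow> f0 \<in> B j"
    "\<And>j f p m. j < k \<Longrightarrow> f \<in> B j \<Longrightarrow> p \<in> L \<Longrightarrow> m \<in> M \<Longrightarrow>
       norm (br (?T f j p) m (snd p j) - br (?T f0 j p) m (snd p j)) < d"
    by simp_all
  let ?B = "A \<inter> ((\<Inter>j<k. B j) \<inter> topspace (smooth_top scE (*) U))"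
  have "openin (smooth_top scE (*) U) ?B"
    using A(1) B(1) by (intro openin_Int openin_INT) auto
  moreover have "f0 \<in> ?B" using A(2) B(2) f0 by auto
  moreover have "norm (m (hamd f k (fst p) (snd p)) - m (hamd f0 k (fst p) (snd p))) < e"
    if f: "f \<in> ?B" and p: "p \<in> L" and m: "m \<in> M" for f p m
  proof -
    have fs: "f \<in> smooth scE (*) U" using f by auto
    have xU: "fst p \<in> U"
      using p compactin_subset_topspace[OF L] by (auto simp: UEk_def)
    note D = ddual_in_dual[OF U fs xU] ddual_in_dual[OF U f0 xU]
    have md: "m \<in> dual scE" by (rule compactin_dual_c_subset[OF M m])
    have "norm (m (hamd f k (fst p) (snd p)) - m (hamd f0 k (fst p) (snd p)))
       = norm ((br (?S f p) m (fst p) - br (?S f0 p) m (fst p))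
           + (\<Sum>j<k. br (?T f j p) m (snd p j) - br (?T f0 j p) m (snd p j)))"
      using md D by (simp add: hamd_def dual_add dual_sum beta sum_subtractf algebra_simps)
    also have "\<dots> \<le> norm (br (?S f p) m (fst p) - br (?S f0 p) m (fst p))
        + (\<Sum>j<k. norm (br (?T f j p) m (snd p j) - br (?T f0 j p) m (snd p j)))"
      by (intro order_trans[OF norm_triangle_ineq] add_left_mono norm_sum)
    also have "\<dots> < d + (\<Sum>j<k. d)"
    \<comment> \<open>The strict inequality is taken from the leading summand, since the sum over
      \<open>j < k\<close> may be empty.\<close>
    proof (rule add_less_le_mono)
      show "norm (br (?S f p) m (fst p) - br (?S f0 p) m (fst p)) < d"
        using A(3) f p m by auto
      show "(\<Sum>j<k. norm (br (?T f j p) m (snd p j) - br (?T f0 j p) m (snd p j))) \<le> (\<Sum>j<k. d)"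
        using B(3) f p m by (intro sum_mono less_imp_le) auto
    qed
    also have "d + (\<Sum>j<k. d) = (real k + 1) * d" by (simp add: distrib_right)
    also have "\<dots> = e"
      unfolding d_def times_divide_eq_right by (rule nonzero_mult_div_cancel_left) linarith
    finally show ?thesis .
  qed
  ultimately show ?thesis by (intro exI[of _ ?B]) auto
qed

text \<open>The pair of compact set and radius given by \<open>E_nhd\<close> depends on the point of
  \<open>W\<close>. Compactness of the image of \<open>L\<close> under the derivative of the field
  of \<open>f0\<close> leaves finitely many pairs, and \<open>hamd_uniform_nhd\<close> treats each
  of them.\<close>

lemma continuous_map_hamvf:
  assumes U: "open U"
  shows "continuous_map (smooth_top scE (*) U) (smooth_top scE scE U) (hamvf scE br U)"
proof (rule continuous_map_into_smooth_top)
  show "hamvf scE br U f \<in> smooth scE scE U" if "f \<in> topspace (smooth_top scE (*) U)" for f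
    using hamvf_smooth[OF U] that by simp
next
  fix k L and W :: "'e set" assume L: "compactin (UEk U k) L" and W: "open W"
  let ?h = "\<lambda>f. iter_d scE scE (hamvf scE br U f) k"
  show "openin (smooth_top scE (*) U) {f \<in> topspace (smooth_top scE (*) U). \<forall>p\<in>L. ?h f p \<in> W}"
  proof (subst openin_subopen, rule ballI)
    fix f0 assume "f0 \<in> {f \<in> topspace (smooth_top scE (*) U). \<forall>p\<in>L. ?h f p \<in> W}"
    then have f0: "f0 \<in> smooth scE (*) U" "\<And>p. p \<in> L \<Longrightarrow> ?h f0 p \<in> W" by auto
    have h: "?h f p = hamd f k (fst p) (snd p)" if "f \<in> smooth scE (*) U" "p \<in> L" for f p
      using that iter_d_hamvf[OF U, of f "fst p" k "snd p"] compactin_subset_topspace[OF L]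
      by (auto simp: UEk_def)
    have "continuous_map (UEk U k) euclidean (?h f0)"
      using hamvf_smooth[OF U f0(1)] by (simp add: smooth_def)
    from image_compactin[OF L this] have cpt: "compact (?h f0 ` L)" by simp
    have "\<forall>y\<in>W. \<exists>M e. compactin (dual_c scE) M \<and> e > 0 \<and>
        (\<forall>y'. (\<forall>m\<in>M. norm (m y' - m y) < e) \<longrightarrow> y' \<in> W)"
    proof
      fix y assume "y \<in> W"
      then show "\<exists>M e. compactin (dual_c scE) M \<and> e > 0 \<and> (\<forall>y'. (\<forall>m\<in>M. norm (m y' - m y) < e) \<longrightarrow> y' \<in> W)"
      proof (rule E_nhd[OF W])
        fix M and e :: real
        assume "compactin (dual_c scE) M" "e > 0" "\<And>y'. (\<And>m. m \<in> M \<Longrightarrow> norm (m y' - m y) < e) \<Longrightarrow> y' \<in> W"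
        then show ?thesis by (intro exI[of _ M] exI[of _ e]) simp
      qed
    qed
    from bchoice[OF this] obtain M where "\<forall>y\<in>W. \<exists>e. compactin (dual_c scE) (M y) \<and> e > 0 \<and>
        (\<forall>y'. (\<forall>m\<in>M y. norm (m y' - m y) < e) \<longrightarrow> y' \<in> W)" by (rule exE)
    from bchoice[OF this] obtain e where "\<forall>y\<in>W. compactin (dual_c scE) (M y) \<and> e y > 0 \<and>
        (\<forall>y'. (\<forall>m\<in>M y. norm (m y' - m y) < e y) \<longrightarrow> y' \<in> W)" by (rule exE)
    then have Me: "\<And>y. y \<in> W \<Longrightarrow> compactin (dual_c scE) (M y)" "\<And>y. y \<in> W \<Longrightarrow> e y > (0::real)"
      "\<And>y y'. y \<in> W \<Longrightarrow> (\<And>m. m \<in> M y \<Longrightarrow> norm (m y' - m y) < e y) \<Longrightarrow> y' \<in> W"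
      by simp_all
    \<comment> \<open>One half of \<open>e y\<close> places the value for \<open>f0\<close> near the
      centre \<open>y\<close>; the other half is left for the change from \<open>f0\<close> to
      \<open>f\<close>.\<close>
    define O' where "O' y = {y'. \<forall>m\<in>M y. norm (m y' - m y) < e y / 2}" for y
    have sub: "?h f0 ` L \<subseteq> W" using f0(2) by auto
    have op: "open (O' y)" if "y \<in> ?h f0 ` L" for y
      unfolding O'_def using sub that by (intro open_uniform_ball Me(1)) auto
    have cov: "?h f0 ` L \<subseteq> (\<Union>y\<in>?h f0 ` L. O' y)"
    proof
      fix y assume y: "y \<in> ?h f0 ` L"
      then have "y \<in> O' y" using Me(2)[OF subsetD[OF sub y]] by (simp add: O'_def)
      with y show "y \<in> (\<Union>y\<in>?h f0 ` L. O' y)" by (rule UN_I)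
    qed
    obtain F where F: "F \<subseteq> ?h f0 ` L" "finite F" "?h f0 ` L \<subseteq> (\<Union>y\<in>F. O' y)"
      by (rule compactE_image[OF cpt op cov])
    have FW: "y \<in> W" if "y \<in> F" for y using F(1) sub that by auto
    have "\<forall>y\<in>F. \<exists>B. openin (smooth_top scE (*) U) B \<and> f0 \<in> B \<and> (\<forall>f\<in>B. \<forall>p\<in>L. \<forall>m\<in>M y.
       norm (m (hamd f k (fst p) (snd p)) - m (hamd f0 k (fst p) (snd p))) < e y / 2)"
      using Me(1,2) FW by (intro ballI hamd_uniform_nhd[OF U f0(1) L]) auto
    from bchoice[OF this] obtain B where "\<forall>y\<in>F. openin (smooth_top scE (*) U) (B y) \<and> f0 \<in> B y \<and>
       (\<forall>f\<in>B y. \<forall>p\<in>L. \<forall>m\<in>M y.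
         norm (m (hamd f k (fst p) (snd p)) - m (hamd f0 k (fst p) (snd p))) < e y / 2)"
      by (rule exE)
    then have B: "\<And>y. y \<in> F \<Longrightarrow> openin (smooth_top scE (*) U) (B y)"
      "\<And>y. y \<in> F \<Longrightarrow> f0 \<in> B y"
      "\<And>y f p m. y \<in> F \<Longrightarrow> f \<in> B y \<Longrightarrow> p \<in> L \<Longrightarrow> m \<in> M y \<Longrightarrow>
         norm (m (hamd f k (fst p) (snd p)) - m (hamd f0 k (fst p) (snd p))) < e y / 2"
      by simp_all
    let ?B = "(\<Inter>y\<in>F. B y) \<inter> topspace (smooth_top scE (*) U)"
    have "openin (smooth_top scE (*) U) ?B"
      using B(1) F(2) by (intro openin_INT) auto
    moreover have "f0 \<in> ?B" using B(2) f0(1) by auto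
    moreover have "?h f p \<in> W" if f: "f \<in> ?B" and p: "p \<in> L" for f p
    proof -
      have "?h f0 p \<in> (\<Union>y\<in>F. O' y)" using F(3) imageI[OF p] by (rule subsetD)
      then obtain y where y: "y \<in> F" "?h f0 p \<in> O' y" by (rule UN_E)
      have fs: "f \<in> smooth scE (*) U" using f by auto
      show ?thesis
      proof (rule Me(3)[OF FW[OF y(1)]])
        fix m assume m: "m \<in> M y"
        have "norm (m (?h f p) - m (?h f0 p)) < e y / 2"
          using B(3)[OF y(1) _ p m, of f] f y(1) by (simp add: h fs f0(1) p)
        moreover have "norm (m (?h f0 p) - m y) < e y / 2"
          using y(2) m by (auto simp: O'_def)
        ultimately show "norm (m (?h f p) - m y) < e y"
          using norm_triangle_ineq[of "m (?h f p) - m (?h f0 p)" "m (?h f0 p) - m y"] by simp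
      qed
    qed
    ultimately show "\<exists>T. openin (smooth_top scE (*) U) T \<and> f0 \<in> T \<and>
        T \<subseteq> {f \<in> topspace (smooth_top scE (*) U). \<forall>p\<in>L. ?h f p \<in> W}"
      by (intro exI[of _ ?B]) auto
  qed
qed

section \<open>Linearity in the function\<close>

lemma hamvf_add:
  assumes U: "open U" and f: "f \<in> smooth scE (*) U" and g: "g \<in> smooth scE (*) U"
  shows "hamvf scE br U (\<lambda>x. f x + g x) = (\<lambda>x. hamvf scE br U f x + hamvf scE br U g x)"
proof
  fix x
  show "hamvf scE br U (\<lambda>x. f x + g x) x = hamvf scE br U f x + hamvf scE br U g x"
  proof (cases "x \<in> U")
    case True
    \<comment> \<open>The derivative of the sum is read off from its difference quotients, which are
      sums of convergent ones; additivity of \<open>beta\<close> in the functional does the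
      rest.\<close>
    have "ddual (\<lambda>x. f x + g x) 0 x ys = (\<lambda>z. ddual f 0 x ys z + ddual g 0 x ys z)" for ys
    proof
      fix z
      have "((\<lambda>t. inverse t * (f (x + scE t z) - f x) + inverse t * (g (x + scE t z) - g x))
          \<longlongrightarrow> ddual f 0 x ys z + ddual g 0 x ys z) (at 0)"
        using smooth_tendsto[OF f True, of 0 "case_nat z ys"] smooth_tendsto[OF g True, of 0 "case_nat z ys"]
        by (intro tendsto_add) (simp_all add: ddual_def)
      then have "((\<lambda>t. inverse t * (f (x + scE t z) + g (x + scE t z) - (f x + g x)))
          \<longlongrightarrow> ddual f 0 x ys z + ddual g 0 x ys z) (at 0)"
        by (simp add: algebra_simps)
      from tendsto_Lim[OF _ this]
      show "ddual (\<lambda>x. f x + g x) 0 x ys z = ddual f 0 x ys z + ddual g 0 x ys z"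
        by (simp add: ddual_def iter_d.simps(2))
    qed
    then show ?thesis
      using ddual_in_dual[OF U f True] ddual_in_dual[OF U g True]
      by (simp add: hamvf_eq_beta[OF True, where ys = "\<lambda>_. 0"] beta_add_right)
  qed (simp add: hamvf_def)
qed

lemma hamvf_scale:
  assumes U: "open U" and f: "f \<in> smooth scE (*) U"
  shows "hamvf scE br U (\<lambda>x. c * f x) = (\<lambda>x. scE c (hamvf scE br U f x))"
proof
  fix x
  show "hamvf scE br U (\<lambda>x. c * f x) x = scE c (hamvf scE br U f x)"
  proof (cases "x \<in> U")
    case True
    have "ddual (\<lambda>x. c * f x) 0 x ys = (\<lambda>z. c * ddual f 0 x ys z)" for ys
    proof
      fix z
      have "((\<lambda>t. c * (inverse t * (f (x + scE t z) - f x))) \<longlongrightarrow> c * ddual f 0 x ys z) (at 0)"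
        using smooth_tendsto[OF f True, of 0 "case_nat z ys"]
        by (intro tendsto_mult_left) (simp add: ddual_def)
      then have "((\<lambda>t. inverse t * (c * f (x + scE t z) - c * f x)) \<longlongrightarrow> c * ddual f 0 x ys z) (at 0)"
        by (simp only: right_diff_distrib mult.left_commute)
      from tendsto_Lim[OF _ this]
      show "ddual (\<lambda>x. c * f x) 0 x ys z = c * ddual f 0 x ys z"
        by (simp add: ddual_def iter_d.simps(2))
    qed
    then show ?thesis
      using ddual_in_dual[OF U f True]
      by (simp add: hamvf_eq_beta[OF True, where ys = "\<lambda>_. 0"] beta_scale_right)
  qed (simp add: hamvf_def)
qed

end

theorem theorem6p1:
  fixes scE :: "'k::real_normed_field \<Rightarrow> 'e::{ab_group_add,t2_space} \<Rightarrow> 'e"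
    and br :: "('e \<Rightarrow> 'k) \<Rightarrow> ('e \<Rightarrow> 'k) \<Rightarrow> ('e \<Rightarrow> 'k)"
    and U :: "'e set"
  assumes "lc_poisson scE br"
    and "open U"
  shows "continuous_map (smooth_top scE (*) U) (smooth_top scE scE U) (hamvf scE br U)
     \<and> (\<forall>f\<in>smooth scE (*) U. \<forall>g\<in>smooth scE (*) U.
          hamvf scE br U (\<lambda>x. f x + g x) = (\<lambda>x. hamvf scE br U f x + hamvf scE br U g x))
     \<and> (\<forall>f\<in>smooth scE (*) U. \<forall>c::'k.
          hamvf scE br U (\<lambda>x. c * f x) = (\<lambda>x. scE c (hamvf scE br U f x)))"
proof -
  interpret poisson_space scE br
    by unfold_locales (rule assms(1))
  show ?thesis
    using continuous_map_hamvf[OF assms(2)] hamvf_add[OF assms(2)] hamvf_scale[OF assms(2)]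
    by (intro conjI ballI allI)
qed

end
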